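(* Let $(M,\omega)$ be a closed connected symplectic manifold equipped with a Riemannian metric $g$. Let $\Phi=\phi_{(U,\mathcal H)}$ be a symplectic isotopy with generator $(U,\mathcal H)$, and let $\epsilon>0$ be a real number. Then there exists a boundary flat symplectic isotopy $\Psi=\psi_{(V,\mathcal K)}$, with generator $(V,\mathcal K)$, with the same extremities as $\Phi$, such that $$D^1((U,\mathcal H),(V,\mathcal K))<\epsilon\quad\text{and}\quad\bar d(\Psi,\Phi)<\epsilon.$$
   Context: $M$ is closed of dimension $2n$. Let $\mathcal H^1(M,g)$ be the space of $g$-harmonic $1$-forms; fix a basis $(h_i)$ and put $|\sum_i\lambda_ih_i|:=\sum_i|\lambda_i|$. A symplectic isotopy is a smooth path $\Phi=\{\phi_t\}_{t\in[0,1]}$ of diffeomorphisms with $\phi_0=\mathrm{id}$ such that for each $t$, $\dot\phi_t:=\frac{d\phi_t}{dt}\circ\phi_t^{-1}$ satisfies $d(\iota(\dot\phi_t)\omega)=0$. By Hodge theory, uniquely $\iota(\dot\phi_t)\omega=dU_t+\mathcal H_t$ with $\mathcal H_t\in\mathcal H^1(M,g)$ and $\int_MU_t\,\omega^n=0$; $(U,\mathcal H)$ is the generator of $\Phi=\phi_{(U,\mathcal H)}$. $\overline{(U,\mathcal H)}$ denotes the generator of the inverse isotopy $\{\phi_t^{-1}\}$. $\Phi=\phi_{(U,\mathcal H)}$ (or $(U,\mathcal H)$) is boundary flat if there is $\delta\in(0,1)$ with $(U_t,\mathcal H_t)=(0,0)$ for all $t\in[0,\delta)\cup(1-\delta,1]$.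 "Same extremities" means the same time-zero and time-one maps. With $\mathrm{osc}(f)=\max f-\min f$, $$D_0((U,\mathcal H),(V,\mathcal K))=\int_0^1\big(\mathrm{osc}(U_t-V_t)+|\mathcal H_t-\mathcal K_t|\big)dt,$$ $$D^1((U,\mathcal H),(V,\mathcal K))=\tfrac12\Big(D_0((U,\mathcal H),(V,\mathcal K))+D_0(\overline{(U,\mathcal H)},\overline{(V,\mathcal K)})\Big).$$ With $d$ the distance induced by $g$, $d_{C^0}(f,h)=\sup_{x}d(f(x),h(x))$, $d_0(f,h)=\max(d_{C^0}(f,h),d_{C^0}(f^{-1},h^{-1}))$ for homeomorphisms, and $\bar d(\lambda,\mu)=\max_{t\in[0,1]}d_0(\lambda(t),\mu(t))$ for paths of homeomorphisms. *)

theory Defs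
  imports "HOL-Analysis.Analysis"
begin

section \<open>Smooth maps between subsets of normed spaces\<close>

primrec Ck_on :: "nat \<Rightarrow> ('a::real_normed_vector \<Rightarrow> 'b::real_normed_vector) \<Rightarrow> 'a set \<Rightarrow> bool" where
  "Ck_on 0 f S \<longleftrightarrow> continuous_on S f"
| "Ck_on (Suc k) f S \<longleftrightarrow>
     (\<forall>x\<in>S. f differentiable (at x)) \<and> (\<forall>v. Ck_on k (\<lambda>x. frechet_derivative f (at x) v) S)"

text \<open>On a set that need not be open (such as \<open>[0,1] \<times> V\<close>) smoothness means that near every point
  the map is the restriction of a smooth map defined on an open set.\<close>

definition smooth_on :: "'a::real_normed_vector set \<Rightarrow> ('a \<Rightarrow> 'b::real_normed_vector) \<Rightarrow> bool" where
  "smooth_on S f \<longleftrightarrow> (\<forall>x\<in>S. \<exists>W F. open W \<and> x \<in> W \<and> (\<forall>k. Ck_on k F W) \<and> (\<forall>y\<in>S \<inter> W. F y = f y))"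

section \<open>Closed manifolds\<close>

text \<open>A chart is a pair of an open domain and a coordinate map; only the values of the map on the
  domain are meaningful. The manifold is the whole type \<open>'m\<close>, its dimension is \<open>CARD('n)\<close>, and its
  smooth structure is the one determined by an atlas \<open>A\<close>, which need not be maximal.\<close>

type_synonym ('m, 'n) chart = "'m set \<times> ('m \<Rightarrow> real^'n)"

abbreviation cimg :: "('m, 'n::finite) chart \<Rightarrow> (real^'n) set" where
  "cimg c \<equiv> snd c ` fst c"

abbreviation cinv :: "('m, 'n::finite) chart \<Rightarrow> real^'n \<Rightarrow> 'm" where
  "cinv c \<equiv> inv_into (fst c) (snd c)"

definition smooth_atlas :: "('m::t2_space, 'n::finite) chart set \<Rightarrow> bool" where
  "smooth_atlas A \<longleftrightarrow>
     (\<forall>c\<in>A. open (fst c) \<and> open (cimg c) \<and> homeomorphism (fst c) (cimg c) (snd c) (cinv c)) \<and>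
     (\<Union>c\<in>A. fst c) = UNIV \<and>
     (\<forall>c\<in>A. \<forall>d\<in>A. smooth_on (snd c ` (fst c \<inter> fst d)) (\<lambda>y. snd d (cinv c y)))"

text \<open>Second countability is automatic for compact locally Euclidean spaces.\<close>

definition closed_connected_manifold :: "('m::t2_space, 'n::finite) chart set \<Rightarrow> bool" where
  "closed_connected_manifold A \<longleftrightarrow>
     smooth_atlas A \<and> compact (UNIV :: 'm set) \<and> connected (UNIV :: 'm set)"

definition smooth_fun :: "('m, 'n::finite) chart set \<Rightarrow> ('m \<Rightarrow> real) \<Rightarrow> bool" where
  "smooth_fun A f \<longleftrightarrow> (\<forall>c\<in>A. smooth_on (cimg c) (\<lambda>y. f (cinv c y)))"

section \<open>Tangent vectors and tensor fields\<close>

text \<open>Tangent vectors are derivations acting on smooth functions; to make equality of derivations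
  equality of functions they are set to \<open>0\<close> on functions that are not smooth. \<open>tvec A c p v\<close> is the
  tangent vector at \<open>p\<close> whose coordinates in the chart \<open>c\<close> are \<open>v\<close>.\<close>

type_synonym 'm tangent = "('m \<Rightarrow> real) \<Rightarrow> real"
type_synonym 'm form1 = "'m \<Rightarrow> 'm tangent \<Rightarrow> real"
type_synonym 'm form2 = "'m \<Rightarrow> 'm tangent \<Rightarrow> 'm tangent \<Rightarrow> real"

definition tvec :: "('m, 'n::finite) chart set \<Rightarrow> ('m, 'n) chart \<Rightarrow> 'm \<Rightarrow> real^'n \<Rightarrow> 'm tangent" where
  "tvec A c p v = (\<lambda>f. if smooth_fun A f
     then frechet_derivative (\<lambda>y. f (cinv c y)) (at (snd c p)) v else 0)"

definition tangent_space :: "('m, 'n::finite) chart set \<Rightarrow> 'm \<Rightarrow> 'm tangent set" where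
  "tangent_space A p = {X. \<exists>c\<in>A. p \<in> fst c \<and> X \<in> range (tvec A c p)}"

text \<open>Tensor fields are functions on all derivations, of which only the values on the tangent spaces
  matter. Their components in a chart, with respect to constant coordinate fields:\<close>

definition comp1 :: "('m, 'n::finite) chart set \<Rightarrow> 'm form1 \<Rightarrow> ('m, 'n) chart \<Rightarrow> real^'n \<Rightarrow> real^'n \<Rightarrow> real" where
  "comp1 A \<alpha> c v y = \<alpha> (cinv c y) (tvec A c (cinv c y) v)"

definition comp2 :: "('m, 'n::finite) chart set \<Rightarrow> 'm form2 \<Rightarrow> ('m, 'n) chart \<Rightarrow> real^'n \<Rightarrow> real^'n \<Rightarrow> real^'n \<Rightarrow> real" where
  "comp2 A \<beta> c v w y = \<beta> (cinv c y) (tvec A c (cinv c y) v) (tvec A c (cinv c y) w)"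

definition smooth_form1 :: "('m, 'n::finite) chart set \<Rightarrow> 'm form1 \<Rightarrow> bool" where
  "smooth_form1 A \<alpha> \<longleftrightarrow> (\<forall>c\<in>A.
     (\<forall>y\<in>cimg c. linear (\<lambda>v. comp1 A \<alpha> c v y)) \<and> (\<forall>v. smooth_on (cimg c) (comp1 A \<alpha> c v)))"

definition smooth_tensor2 :: "('m, 'n::finite) chart set \<Rightarrow> 'm form2 \<Rightarrow> bool" where
  "smooth_tensor2 A \<beta> \<longleftrightarrow> (\<forall>c\<in>A.
     (\<forall>y\<in>cimg c. bilinear (\<lambda>v w. comp2 A \<beta> c v w y)) \<and> (\<forall>v w. smooth_on (cimg c) (comp2 A \<beta> c v w)))"

definition smooth_form2 :: "('m, 'n::finite) chart set \<Rightarrow> 'm form2 \<Rightarrow> bool" where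
  "smooth_form2 A \<beta> \<longleftrightarrow> smooth_tensor2 A \<beta> \<and> (\<forall>p. \<forall>X\<in>tangent_space A p. \<beta> p X X = 0)"

definition d_fun :: "('m \<Rightarrow> real) \<Rightarrow> 'm form1" where
  "d_fun f = (\<lambda>p X. X f)"

text \<open>\<open>is_d1 A \<alpha> \<beta>\<close> says \<open>\<beta> = d\<alpha>\<close>.\<close>

definition is_d1 :: "('m, 'n::finite) chart set \<Rightarrow> 'm form1 \<Rightarrow> 'm form2 \<Rightarrow> bool" where
  "is_d1 A \<alpha> \<beta> \<longleftrightarrow> (\<forall>c\<in>A. \<forall>y\<in>cimg c. \<forall>v w. comp2 A \<beta> c v w y =
     frechet_derivative (comp1 A \<alpha> c w) (at y) v - frechet_derivative (comp1 A \<alpha> c v) (at y) w)"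

definition closed_form1 :: "('m, 'n::finite) chart set \<Rightarrow> 'm form1 \<Rightarrow> bool" where
  "closed_form1 A \<alpha> \<longleftrightarrow> smooth_form1 A \<alpha> \<and> is_d1 A \<alpha> (\<lambda>p X Y. 0)"

definition closed_form2 :: "('m, 'n::finite) chart set \<Rightarrow> 'm form2 \<Rightarrow> bool" where
  "closed_form2 A \<beta> \<longleftrightarrow> smooth_form2 A \<beta> \<and> (\<forall>c\<in>A. \<forall>y\<in>cimg c. \<forall>u v w.
     frechet_derivative (comp2 A \<beta> c v w) (at y) u - frechet_derivative (comp2 A \<beta> c u w) (at y) v
       + frechet_derivative (comp2 A \<beta> c u v) (at y) w = 0)"

definition symplectic_form :: "('m, 'n::finite) chart set \<Rightarrow> 'm form2 \<Rightarrow> bool" where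
  "symplectic_form A \<omega> \<longleftrightarrow> closed_form2 A \<omega> \<and>
     (\<forall>p. \<forall>X\<in>tangent_space A p. (\<forall>Y\<in>tangent_space A p. \<omega> p X Y = 0) \<longrightarrow> X = (\<lambda>f. 0))"

definition riemannian_metric :: "('m, 'n::finite) chart set \<Rightarrow> 'm form2 \<Rightarrow> bool" where
  "riemannian_metric A g \<longleftrightarrow> smooth_tensor2 A g \<and>
     (\<forall>p. \<forall>X\<in>tangent_space A p. (\<forall>Y\<in>tangent_space A p. g p X Y = g p Y X) \<and>
        (X \<noteq> (\<lambda>f. 0) \<longrightarrow> g p X X > 0))"

section \<open>Integration\<close>

text \<open>The Borel measure on the manifold that has density \<open>\<rho> c\<close> with respect to Lebesgue measure in
  every chart \<open>c\<close>. It is unique, and exists when \<open>\<rho>\<close> is a continuous nonnegative density, that is,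
  transforms with the absolute value of the Jacobian.\<close>

definition density_measure ::
    "('m::topological_space, 'n::finite) chart set \<Rightarrow> (('m, 'n) chart \<Rightarrow> 'm \<Rightarrow> real) \<Rightarrow> 'm measure" where
  "density_measure A \<rho> = (THE \<mu>. sets \<mu> = sets borel \<and>
     (\<forall>c\<in>A. \<forall>B\<in>sets borel. B \<subseteq> fst c \<longrightarrow>
        emeasure \<mu> B = (\<integral>\<^sup>+ y. ennreal (\<rho> c (cinv c y)) * indicator (snd c ` B) y \<partial>lborel)))"

definition riemannian_volume :: "('m::topological_space, 'n::finite) chart set \<Rightarrow> 'm form2 \<Rightarrow> 'm measure" where
  "riemannian_volume A g = density_measure A (\<lambda>c p.
     sqrt (det (\<chi> i j. g p (tvec A c p (axis i 1)) (tvec A c p (axis j 1)))))"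

text \<open>\<open>(\<omega> \<and> \<dots> \<and> \<omega>)(X\<^sub>0, \<dots>, X\<^sub>2\<^sub>n\<^sub>-\<^sub>1)\<close> with \<open>n\<close> factors.\<close>

definition wedge_power :: "nat \<Rightarrow> 'm form2 \<Rightarrow> 'm \<Rightarrow> (nat \<Rightarrow> 'm tangent) \<Rightarrow> real" where
  "wedge_power n \<omega> p X = (1 / 2 ^ n) *
     (\<Sum>\<sigma> | \<sigma> permutes {..<2*n}. of_int (sign \<sigma>) * (\<Prod>i<n. \<omega> p (X (\<sigma> (2*i))) (X (\<sigma> (2*i+1)))))"

text \<open>The measure \<open>f \<mapsto> \<integral> f \<omega>\<^sup>n\<close>, where the manifold carries the orientation given by \<open>\<omega>\<^sup>n\<close>, so that
  the density is \<open>\<bar>\<omega>\<^sup>n(\<partial>\<^sub>1, \<dots>, \<partial>\<^sub>2\<^sub>n)\<bar>\<close>; because of the absolute value the order in which \<open>e\<close> enumerates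
  the coordinates is irrelevant.\<close>

definition symplectic_volume :: "('m::topological_space, 'n::finite) chart set \<Rightarrow> nat \<Rightarrow> 'm form2 \<Rightarrow> 'm measure" where
  "symplectic_volume A n \<omega> = density_measure A (\<lambda>c p.
     let e = (SOME e :: nat \<Rightarrow> 'n. bij_betw e {..<2*n} UNIV)
     in \<bar>wedge_power n \<omega> p (\<lambda>k. tvec A c p (axis (e k) 1))\<bar>)"

section \<open>Harmonic 1-forms\<close>

definition onb :: "('m, 'n::finite) chart set \<Rightarrow> 'm form2 \<Rightarrow> 'm \<Rightarrow> ('n \<Rightarrow> 'm tangent) \<Rightarrow> bool" where
  "onb A g p E \<longleftrightarrow> (\<forall>i. E i \<in> tangent_space A p) \<and> (\<forall>i j. g p (E i) (E j) = (if i = j then 1 else 0))"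

text \<open>Pointwise inner products of 1-forms and 2-forms, which do not depend on the orthonormal basis
  chosen; the factor \<open>1/2\<close> turns the sum over all \<open>i, j\<close> into one over \<open>i < j\<close>.\<close>

definition inner1 :: "('m, 'n::finite) chart set \<Rightarrow> 'm form2 \<Rightarrow> 'm form1 \<Rightarrow> 'm form1 \<Rightarrow> 'm \<Rightarrow> real" where
  "inner1 A g \<alpha> \<beta> p = (let E = (SOME E. onb A g p E) in \<Sum>i\<in>UNIV. \<alpha> p (E i) * \<beta> p (E i))"

definition inner2 :: "('m, 'n::finite) chart set \<Rightarrow> 'm form2 \<Rightarrow> 'm form2 \<Rightarrow> 'm form2 \<Rightarrow> 'm \<Rightarrow> real" where
  "inner2 A g \<alpha> \<beta> p = (let E = (SOME E. onb A g p E) in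
     (1/2) * (\<Sum>i\<in>UNIV. \<Sum>j\<in>UNIV. \<alpha> p (E i) (E j) * \<beta> p (E i) (E j)))"

text \<open>The codifferential \<open>d\<^sup>*\<close> is the formal \<open>L\<^sup>2\<close>-adjoint of \<open>d\<close>: \<open>is_codiff1\<close> says \<open>d\<^sup>*\<alpha> = u\<close>
  for a 1-form \<open>\<alpha>\<close>, and \<open>is_codiff2\<close> says \<open>d\<^sup>*\<beta> = \<gamma>\<close> for a 2-form \<open>\<beta>\<close>.\<close>

definition is_codiff1 :: "('m::topological_space, 'n::finite) chart set \<Rightarrow> 'm form2 \<Rightarrow> 'm form1 \<Rightarrow> ('m \<Rightarrow> real) \<Rightarrow> bool" where
  "is_codiff1 A g \<alpha> u \<longleftrightarrow> smooth_fun A u \<and> (\<forall>f. smooth_fun A f \<longrightarrow>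
     (\<integral>p. u p * f p \<partial>riemannian_volume A g) = (\<integral>p. inner1 A g \<alpha> (d_fun f) p \<partial>riemannian_volume A g))"

definition is_codiff2 :: "('m::topological_space, 'n::finite) chart set \<Rightarrow> 'm form2 \<Rightarrow> 'm form2 \<Rightarrow> 'm form1 \<Rightarrow> bool" where
  "is_codiff2 A g \<beta> \<gamma> \<longleftrightarrow> smooth_form1 A \<gamma> \<and> (\<forall>\<eta> \<theta>. smooth_form1 A \<eta> \<longrightarrow> smooth_form2 A \<theta> \<longrightarrow> is_d1 A \<eta> \<theta> \<longrightarrow>
     (\<integral>p. inner1 A g \<gamma> \<eta> p \<partial>riemannian_volume A g) = (\<integral>p. inner2 A g \<beta> \<theta> p \<partial>riemannian_volume A g))"

text \<open>Harmonic means \<open>\<Delta>\<alpha> = dd\<^sup>*\<alpha> + d\<^sup>*d\<alpha> = 0\<close>.\<close>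

definition harmonic1 :: "('m::topological_space, 'n::finite) chart set \<Rightarrow> 'm form2 \<Rightarrow> 'm form1 \<Rightarrow> bool" where
  "harmonic1 A g \<alpha> \<longleftrightarrow> smooth_form1 A \<alpha> \<and>
     (\<exists>u \<beta> \<gamma>. is_codiff1 A g \<alpha> u \<and> smooth_form2 A \<beta> \<and> is_d1 A \<alpha> \<beta> \<and> is_codiff2 A g \<beta> \<gamma> \<and>
        (\<forall>p. \<forall>X\<in>tangent_space A p. d_fun u p X + \<gamma> p X = 0))"

definition harmonic_basis ::
    "('m::topological_space, 'n::finite) chart set \<Rightarrow> 'm form2 \<Rightarrow> nat \<Rightarrow> (nat \<Rightarrow> 'm form1) \<Rightarrow> bool" where
  "harmonic_basis A g b h \<longleftrightarrow> (\<forall>i<b. harmonic1 A g (h i)) \<and>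
     (\<forall>l. (\<forall>p. \<forall>X\<in>tangent_space A p. (\<Sum>i<b. l i * h i p X) = 0) \<longrightarrow> (\<forall>i<b. l i = 0)) \<and>
     (\<forall>\<alpha>. harmonic1 A g \<alpha> \<longrightarrow> (\<exists>l. \<forall>p. \<forall>X\<in>tangent_space A p. \<alpha> p X = (\<Sum>i<b. l i * h i p X)))"

definition hnorm :: "('m, 'n::finite) chart set \<Rightarrow> nat \<Rightarrow> (nat \<Rightarrow> 'm form1) \<Rightarrow> 'm form1 \<Rightarrow> real" where
  "hnorm A b h \<alpha> = (THE s. \<exists>l. (\<forall>p. \<forall>X\<in>tangent_space A p. \<alpha> p X = (\<Sum>i<b. l i * h i p X)) \<and>
     s = (\<Sum>i<b. \<bar>l i\<bar>))"

section \<open>Symplectic isotopies and their generators\<close>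

definition smooth_map_family :: "('m::topological_space, 'n::finite) chart set \<Rightarrow> (real \<Rightarrow> 'm \<Rightarrow> 'm) \<Rightarrow> bool" where
  "smooth_map_family A \<Phi> \<longleftrightarrow> continuous_on ({0..1} \<times> UNIV) (\<lambda>(t, x). \<Phi> t x) \<and>
     (\<forall>c\<in>A. \<forall>d\<in>A. smooth_on {(t, y). t \<in> {0..1} \<and> y \<in> cimg c \<and> \<Phi> t (cinv c y) \<in> fst d}
        (\<lambda>(t, y). snd d (\<Phi> t (cinv c y))))"

text \<open>Only times in \<open>[0,1]\<close> are relevant. That the inverses form a smooth family is equivalent, by the
  inverse function theorem, to each \<open>\<Phi> t\<close> being a diffeomorphism.\<close>

definition smooth_isotopy :: "('m::topological_space, 'n::finite) chart set \<Rightarrow> (real \<Rightarrow> 'm \<Rightarrow> 'm) \<Rightarrow> bool" where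
  "smooth_isotopy A \<Phi> \<longleftrightarrow> smooth_map_family A \<Phi> \<and> (\<forall>t\<in>{0..1}. bij (\<Phi> t)) \<and>
     smooth_map_family A (\<lambda>t. inv (\<Phi> t)) \<and> \<Phi> 0 = id"

text \<open>The velocity of a curve parametrised by an interval \<open>I\<close>, as a derivation (one-sided at end
  points).\<close>

definition curve_velocity ::
    "('m, 'n::finite) chart set \<Rightarrow> real set \<Rightarrow> (real \<Rightarrow> 'm) \<Rightarrow> real \<Rightarrow> 'm tangent" where
  "curve_velocity A I \<gamma> t =
     (\<lambda>f. if smooth_fun A f then vector_derivative (\<lambda>s. f (\<gamma> s)) (at t within I) else 0)"

definition isotopy_field :: "('m, 'n::finite) chart set \<Rightarrow> (real \<Rightarrow> 'm \<Rightarrow> 'm) \<Rightarrow> real \<Rightarrow> 'm \<Rightarrow> 'm tangent" where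
  "isotopy_field A \<Phi> t p = curve_velocity A {0..1} (\<lambda>s. \<Phi> s (inv (\<Phi> t) p)) t"

definition contraction :: "('m \<Rightarrow> 'm tangent) \<Rightarrow> 'm form2 \<Rightarrow> 'm form1" where
  "contraction X \<omega> = (\<lambda>p Y. \<omega> p (X p) Y)"

definition symplectic_isotopy ::
    "('m::topological_space, 'n::finite) chart set \<Rightarrow> 'm form2 \<Rightarrow> (real \<Rightarrow> 'm \<Rightarrow> 'm) \<Rightarrow> bool" where
  "symplectic_isotopy A \<omega> \<Phi> \<longleftrightarrow> smooth_isotopy A \<Phi> \<and>
     (\<forall>t\<in>{0..1}. closed_form1 A (contraction (isotopy_field A \<Phi> t) \<omega>))"

definition inverse_isotopy :: "(real \<Rightarrow> 'm \<Rightarrow> 'm) \<Rightarrow> real \<Rightarrow> 'm \<Rightarrow> 'm" where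
  "inverse_isotopy \<Phi> = (\<lambda>t. inv (\<Phi> t))"

definition smooth_fun_family :: "('m, 'n::finite) chart set \<Rightarrow> (real \<Rightarrow> 'm \<Rightarrow> real) \<Rightarrow> bool" where
  "smooth_fun_family A U \<longleftrightarrow> (\<forall>c\<in>A. smooth_on ({0..1} \<times> cimg c) (\<lambda>(t, y). U t (cinv c y)))"

definition smooth_form1_family :: "('m, 'n::finite) chart set \<Rightarrow> (real \<Rightarrow> 'm form1) \<Rightarrow> bool" where
  "smooth_form1_family A H \<longleftrightarrow>
     (\<forall>c\<in>A. \<forall>v. smooth_on ({0..1} \<times> cimg c) (\<lambda>(t, y). comp1 A (H t) c v y))"

type_synonym 'm generator = "(real \<Rightarrow> 'm \<Rightarrow> real) \<times> (real \<Rightarrow> 'm form1)"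

text \<open>The generator of a symplectic isotopy consists of smooth families; by Hodge theory it exists
  and is unique (on \<open>[0,1]\<close> and on tangent vectors).\<close>

definition is_generator ::
    "('m::topological_space, 'n::finite) chart set \<Rightarrow> nat \<Rightarrow> 'm form2 \<Rightarrow> 'm form2 \<Rightarrow>
       (real \<Rightarrow> 'm \<Rightarrow> 'm) \<Rightarrow> 'm generator \<Rightarrow> bool" where
  "is_generator A n \<omega> g \<Phi> = (\<lambda>(U, H). smooth_fun_family A U \<and> smooth_form1_family A H \<and>
     (\<forall>t\<in>{0..1}.
        harmonic1 A g (H t) \<and> (\<integral>p. U t p \<partial>symplectic_volume A n \<omega>) = 0 \<and>
        (\<forall>p. \<forall>X\<in>tangent_space A p.
           contraction (isotopy_field A \<Phi> t) \<omega> p X = d_fun (U t) p X + H t p X)))"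

definition boundary_flat :: "('m, 'n::finite) chart set \<Rightarrow> 'm generator \<Rightarrow> bool" where
  "boundary_flat A = (\<lambda>(U, H). \<exists>\<delta>. 0 < \<delta> \<and> \<delta> < 1 \<and> (\<forall>t\<in>{0..<\<delta>} \<union> {1-\<delta><..1}.
     (\<forall>p. U t p = 0) \<and> (\<forall>p. \<forall>X\<in>tangent_space A p. H t p X = 0)))"

section \<open>Distances\<close>

definition osc :: "('m \<Rightarrow> real) \<Rightarrow> real" where
  "osc f = (SUP x. f x) - (INF x. f x)"

definition D0 :: "('m, 'n::finite) chart set \<Rightarrow> nat \<Rightarrow> (nat \<Rightarrow> 'm form1) \<Rightarrow> 'm generator \<Rightarrow> 'm generator \<Rightarrow> real" where
  "D0 A b h = (\<lambda>(U, H) (V, K). integral {0..1}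
     (\<lambda>t. osc (\<lambda>x. U t x - V t x) + hnorm A b h (\<lambda>p X. H t p X - K t p X)))"

text \<open>The arguments \<open>G'\<close> and \<open>L'\<close> are the generators of the isotopies inverse to those generated by
  \<open>G\<close> and \<open>L\<close>.\<close>

definition D1 :: "('m, 'n::finite) chart set \<Rightarrow> nat \<Rightarrow> (nat \<Rightarrow> 'm form1) \<Rightarrow>
    'm generator \<Rightarrow> 'm generator \<Rightarrow> 'm generator \<Rightarrow> 'm generator \<Rightarrow> real" where
  "D1 A b h G G' L L' = (1/2) * (D0 A b h G L + D0 A b h G' L')"

definition smooth_curve_on :: "('m::topological_space, 'n::finite) chart set \<Rightarrow> real set \<Rightarrow> (real \<Rightarrow> 'm) \<Rightarrow> bool" where
  "smooth_curve_on A I \<gamma> \<longleftrightarrow> continuous_on I \<gamma> \<and>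
     (\<forall>c\<in>A. smooth_on {s\<in>I. \<gamma> s \<in> fst c} (\<lambda>s. snd c (\<gamma> s)))"

definition piecewise_smooth_curve :: "('m::topological_space, 'n::finite) chart set \<Rightarrow> (real \<Rightarrow> 'm) \<Rightarrow> bool" where
  "piecewise_smooth_curve A \<gamma> \<longleftrightarrow> (\<exists>k \<tau>. \<tau> 0 = 0 \<and> \<tau> k = 1 \<and>
     (\<forall>i<k. \<tau> i < \<tau> (Suc i) \<and> smooth_curve_on A {\<tau> i..\<tau> (Suc i)} \<gamma>))"

text \<open>The velocity may be meaningless at the finitely many break points, which do not affect the
  integral.\<close>

definition curve_length :: "('m, 'n::finite) chart set \<Rightarrow> 'm form2 \<Rightarrow> (real \<Rightarrow> 'm) \<Rightarrow> real" where
  "curve_length A g \<gamma> = integral {0..1}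
     (\<lambda>s. sqrt (g (\<gamma> s) (curve_velocity A {0..1} \<gamma> s) (curve_velocity A {0..1} \<gamma> s)))"

definition rdist :: "('m::topological_space, 'n::finite) chart set \<Rightarrow> 'm form2 \<Rightarrow> 'm \<Rightarrow> 'm \<Rightarrow> real" where
  "rdist A g p q = Inf {curve_length A g \<gamma> | \<gamma>. piecewise_smooth_curve A \<gamma> \<and> \<gamma> 0 = p \<and> \<gamma> 1 = q}"

definition dC0 :: "('m::topological_space, 'n::finite) chart set \<Rightarrow> 'm form2 \<Rightarrow> ('m \<Rightarrow> 'm) \<Rightarrow> ('m \<Rightarrow> 'm) \<Rightarrow> real" where
  "dC0 A g f k = (SUP x. rdist A g (f x) (k x))"

definition d0 :: "('m::topological_space, 'n::finite) chart set \<Rightarrow> 'm form2 \<Rightarrow> ('m \<Rightarrow> 'm) \<Rightarrow> ('m \<Rightarrow> 'm) \<Rightarrow> real" where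
  "d0 A g f k = max (dC0 A g f k) (dC0 A g (inv f) (inv k))"

definition dbar :: "('m::topological_space, 'n::finite) chart set \<Rightarrow> 'm form2 \<Rightarrow>
    (real \<Rightarrow> 'm \<Rightarrow> 'm) \<Rightarrow> (real \<Rightarrow> 'm \<Rightarrow> 'm) \<Rightarrow> real" where
  "dbar A g \<Lambda> M = (SUP t\<in>{0..1}. d0 A g (\<Lambda> t) (M t))"

end

theory Submission
  imports Defs
begin

text \<open>Take \<open>\<Psi>\<^sub>t = \<Phi>\<^bsub>\<xi>(t)\<^esub>\<close> with \<open>\<xi>\<close> a smooth self-map of \<open>[0,1]\<close> that is locally constant near the end points and
  the identity on \<open>[2\<delta>, 1 - 2\<delta>]\<close>, with \<open>\<xi>'\<close> bounded independently of \<open>\<delta>\<close>. By the chain rule its generator is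
  \<open>(\<xi>' U\<^bsub>\<xi>\<^esub>, \<xi>' H\<^bsub>\<xi>\<^esub>)\<close>, and the inverse isotopy is reparametrised in the same way. The integrand of
  \<open>D\<^sub>0\<close> is bounded, by compactness, and vanishes outside a set of measure \<open>O(\<delta>)\<close>. The curve
  \<open>s \<mapsto> \<Phi>\<^sub>s x\<close> between the times \<open>t\<close> and \<open>\<xi>(t)\<close> has length at most a constant times
  \<open>\<bar>\<xi>(t) - t\<bar> \<le> 2\<delta>\<close>, which bounds the uniform distance. As \<open>integral\<close> is \<open>0\<close> on functions that are
  not integrable, no measurability has to be shown for these upper bounds.\<close>

section \<open>Calculus of smooth maps\<close>

text \<open>Between \<open>\<delta>\<close> and \<open>2*\<delta>\<close> the function
  \<open>\<xi>\<close> has to catch up with the identity, so \<open>\<xi>'\<close> goes from 0 to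
  values above 1 and the two generators are in general not uniformly close in time. Only the time
  integral in \<open>D0\<close> becomes small, which is why the bound on \<open>\<xi>'\<close> has
  to survive \<open>\<delta>\<close> tending to 0. The factor \<open>\<xi>'\<close> at time t is
  constant on the manifold. Scaling by it preserves harmonicity and zero mean, so the generators of
  the new isotopy and of its inverse are written down directly; neither existence nor uniqueness in
  Hodge theory is invoked. What needs work is uniformity in t. The functions are bounded by
  compactness of [0,1] x M; the harmonic parts are bounded through their coefficients, which are
  controlled by evaluation at tangent vectors, so that no topology on a space of forms enters.
  Smoothness on the closed time interval means local extendability. Since \<open>\<xi>\<close> is
  smooth on the whole line, composing with it turns local extensions into local extensions.\<close>

lemma Ck_on_subset: "Ck_on k f S \<Longrightarrow> T \<subseteq> S \<Longrightarrow> Ck_on k f T"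
  by (induction k arbitrary: f) (auto intro: continuous_on_subset)

text \<open>The choice operator in \<open>frechet_derivative\<close> sees a function only through
  its set of derivatives at x, which depends on the germ alone. Hence the equality holds even where
  no derivative exists.\<close>

lemma frechet_derivative_cong_open:
  assumes "open S" "x \<in> S" "\<And>y. y \<in> S \<Longrightarrow> f y = g y"
  shows "frechet_derivative f (at x) = frechet_derivative g (at x)"
proof -
  have "(f has_derivative D) (at x) \<longleftrightarrow> (g has_derivative D) (at x)" for D
    using has_derivative_transform_within_open[OF _ assms(1,2), of f D UNIV g]
      has_derivative_transform_within_open[OF _ assms(1,2), of g D UNIV f] assms(3) by auto
  then show ?thesis unfolding frechet_derivative_def by presburger
qed

lemma differentiable_cong_open:
  assumes "open S" "x \<in> S" "\<And>y. y \<in> S \<Longrightarrow> f y = g y" "f differentiable (at x)"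
  shows "g differentiable (at x)"
  using assms has_derivative_transform_within_open[OF _ assms(1,2), of f _ UNIV g]
  unfolding differentiable_def by auto

lemma Ck_on_cong:
  assumes "open S" "\<And>x. x \<in> S \<Longrightarrow> f x = g x" "Ck_on k f S"
  shows "Ck_on k g S"
  using assms(2,3)
proof (induction k arbitrary: f g)
  case 0
  then show ?case using continuous_on_cong[OF refl, of S f g] by simp
next
  case (Suc k)
  have "g differentiable at x" if "x \<in> S" for x
    using differentiable_cong_open[OF assms(1) that, of f g] Suc.prems that by auto
  moreover have "Ck_on k (\<lambda>x. frechet_derivative g (at x) v) S" for v
  proof (rule Suc.IH)
    show "Ck_on k (\<lambda>x. frechet_derivative f (at x) v) S" using Suc.prems by simp
    show "frechet_derivative f (at x) v = frechet_derivative g (at x) v" if "x \<in> S" for x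
      using frechet_derivative_cong_open[OF assms(1) that, of f g] Suc.prems by simp
  qed
  ultimately show ?case by simp
qed

text \<open>Allows a closure proof to exhibit its derivative by a differentiation rule; uniqueness
  of derivatives and \<open>Ck_on_cong\<close> exchange it for the chosen
  \<open>frechet_derivative\<close>.\<close>

lemma Ck_on_SucI:
  assumes "open S" "\<And>x. x \<in> S \<Longrightarrow> (f has_derivative f' x) (at x)"
    "\<And>v. Ck_on k (\<lambda>x. f' x v) S"
  shows "Ck_on (Suc k) f S"
proof -
  have "Ck_on k (\<lambda>x. frechet_derivative f (at x) v) S" for v
    by (rule Ck_on_cong[OF assms(1) _ assms(3)[of v]])
      (simp add: frechet_derivative_at[OF assms(2)])
  then show ?thesis using assms(2) by (auto simp: differentiable_def)
qed

lemma Ck_on_SucD: "Ck_on (Suc k) f S \<Longrightarrow> Ck_on k f S"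
proof (induction k arbitrary: f)
  case 0
  then show ?case
    by (auto intro!: continuous_at_imp_continuous_on differentiable_imp_continuous_within)
next
  case (Suc k)
  then show ?case by (metis Ck_on.simps(2))
qed

lemma Ck_on_has_derivative:
  "Ck_on (Suc k) f S \<Longrightarrow> x \<in> S \<Longrightarrow> (f has_derivative frechet_derivative f (at x)) (at x)"
  by (simp add: frechet_derivative_works)

lemma Ck_on_const: "Ck_on k (\<lambda>x. c) S"
  by (induction k arbitrary: c) auto

lemma Ck_on_bounded_linear:
  assumes "bounded_linear f" "open S"
  shows "Ck_on k f S"
proof (cases k)
  case 0
  then show ?thesis using assms by (simp add: linear_continuous_on)
next
  case (Suc m)
  show ?thesis unfolding Suc using assms
    by (intro Ck_on_SucI[where f'="\<lambda>x. f"])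
      (auto simp: bounded_linear_imp_has_derivative intro: Ck_on_const)
qed

lemma Ck_on_add:
  assumes "open S" "Ck_on k f S" "Ck_on k g S"
  shows "Ck_on k (\<lambda>x. f x + g x) S"
  using assms(2,3)
proof (induction k arbitrary: f g)
  case 0
  then show ?case by (auto intro: continuous_intros)
next
  case (Suc k)
  show ?case
    by (rule Ck_on_SucI[OF assms(1) has_derivative_add])
      (use Suc in \<open>auto simp: frechet_derivative_works\<close>)
qed

text \<open>One induction in the locale covers multiplication, scaling and inner product. By the
  Leibniz rule each summand pairs a differentiated factor with an undifferentiated one, whose order
  \<open>Ck_on_SucD\<close> lowers to match.\<close>

lemma (in bounded_bilinear) Ck_on:
  assumes "open S" "Ck_on k f S" "Ck_on k g S"
  shows "Ck_on k (\<lambda>x. prod (f x) (g x)) S"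
  using assms(2,3)
proof (induction k arbitrary: f g)
  case 0
  then show ?case by (auto intro: continuous_on)
next
  case (Suc k)
  have fg: "Ck_on k f S" "Ck_on k g S" using Suc.prems Ck_on_SucD by blast+
  show ?case
  proof (rule Ck_on_SucI[OF assms(1)])
    show "((\<lambda>x. prod (f x) (g x)) has_derivative
        (\<lambda>h. prod (f x) (frechet_derivative g (at x) h) + prod (frechet_derivative f (at x) h) (g x)))
        (at x)" if "x \<in> S" for x
      by (rule FDERIV) (use that Suc.prems Ck_on_has_derivative in blast)+
    show "Ck_on k (\<lambda>x. prod (f x) (frechet_derivative g (at x) v)
        + prod (frechet_derivative f (at x) v) (g x)) S" for v
      by (intro Ck_on_add assms(1) Suc.IH fg) (use Suc.prems in auto)
  qed
qed

lemmas Ck_on_mult = bounded_bilinear.Ck_on[OF bounded_bilinear_mult]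
lemmas Ck_on_scaleR = bounded_bilinear.Ck_on[OF bounded_bilinear_scaleR]
lemmas Ck_on_inner = bounded_bilinear.Ck_on[OF bounded_bilinear_inner]

lemma Ck_on_sum:
  assumes "open S" "\<And>i. i \<in> I \<Longrightarrow> Ck_on k (f i) S"
  shows "Ck_on k (\<lambda>x. \<Sum>i\<in>I. f i x) S"
  using assms(2)
  by (induction I rule: infinite_finite_induct) (auto intro: Ck_on_const Ck_on_add[OF assms(1)])

text \<open>The chain rule differentiates \<open>F\<close> in a direction that varies with x, while
  \<open>Ck_on\<close> controls derivatives in fixed directions only. Expanding the direction in the
  basis gives a finite sum of products to which the induction hypothesis applies; hence the
  Euclidean type in the middle.\<close>

lemma Ck_on_compose:
  fixes G :: "'a::real_normed_vector \<Rightarrow> 'b::euclidean_space" and F :: "'b \<Rightarrow> 'c::real_normed_vector"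
  assumes "open S" "open T" "G ` S \<subseteq> T" "Ck_on k F T" "Ck_on k G S"
  shows "Ck_on k (\<lambda>x. F (G x)) S"
  using assms(4,5)
proof (induction k arbitrary: F)
  case 0
  then show ?case using assms(3) by (auto intro: continuous_on_compose2)
next
  case (Suc k)
  have G: "Ck_on k G S" using Suc.prems Ck_on_SucD by blast
  let ?D = "\<lambda>x v. \<Sum>i\<in>Basis. (frechet_derivative G (at x) v \<bullet> i) *\<^sub>R frechet_derivative F (at (G x)) i"
  show ?case
  proof (rule Ck_on_SucI[OF assms(1), where f'="?D"])
    fix x assume x: "x \<in> S"
    have F: "(F has_derivative frechet_derivative F (at (G x))) (at (G x))"
      using x assms(3) by (intro Ck_on_has_derivative[OF Suc.prems(1)]) auto
    have D: "((\<lambda>x. F (G x)) has_derivative (\<lambda>v. frechet_derivative F (at (G x)) (frechet_derivative G (at x) v))) (at x)"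
      using diff_chain_at[OF Ck_on_has_derivative[OF Suc.prems(2) x] F] by (simp add: o_def)
    have "frechet_derivative F (at (G x)) w = (\<Sum>i\<in>Basis. (w \<bullet> i) *\<^sub>R frechet_derivative F (at (G x)) i)" for w
    proof -
      have lin: "linear (frechet_derivative F (at (G x)))"
        using F has_derivative_linear by blast
      have "frechet_derivative F (at (G x)) w = frechet_derivative F (at (G x)) (\<Sum>i\<in>Basis. (w \<bullet> i) *\<^sub>R i)"
        by (simp add: euclidean_representation)
      also have "\<dots> = (\<Sum>i\<in>Basis. (w \<bullet> i) *\<^sub>R frechet_derivative F (at (G x)) i)"
        by (simp add: linear_sum[OF lin] linear_cmul[OF lin])
      finally show ?thesis .
    qed
    then have "(\<lambda>v. frechet_derivative F (at (G x)) (frechet_derivative G (at x) v)) = ?D x" by blast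
    with D show "((\<lambda>x. F (G x)) has_derivative ?D x) (at x)" by (rule back_subst)
  next
    fix v
    have "Ck_on k (\<lambda>x. frechet_derivative G (at x) v) S" using Suc.prems by simp
    moreover have "Ck_on k (\<lambda>x. frechet_derivative F (at (G x)) i) S" for i
      using Suc.IH[of "\<lambda>y. frechet_derivative F (at y) i"] Suc.prems G by simp
    ultimately show "Ck_on k (\<lambda>x. ?D x v) S"
      by (intro Ck_on_sum Ck_on_scaleR Ck_on_inner assms(1) Ck_on_const)
  qed
qed

text \<open>The derivative of the inverse is minus its own square, so the induction closes under
  products.\<close>

lemma Ck_on_inverse: "Ck_on k (inverse :: real \<Rightarrow> real) (- {0})"
proof (induction k)
  case 0
  then show ?case by (auto intro: continuous_intros)
next
  case (Suc k)
  show ?case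
  proof (rule Ck_on_SucI[where f'="\<lambda>x v. (inverse x * inverse x) * (- v)"])
    show "(inverse has_derivative (\<lambda>v. inverse x * inverse x * - v)) (at x)" if "x \<in> - {0}" for x :: real
      using that by (auto intro!: derivative_eq_intros)
    show "Ck_on k (\<lambda>x. inverse x * inverse x * - v) (- {0})" for v :: real
      by (intro Ck_on_mult Suc.IH Ck_on_const) auto
  qed auto
qed

lemma Ck_on_Pair:
  assumes "open S" "Ck_on k f S" "Ck_on k g S"
  shows "Ck_on k (\<lambda>x. (f x, g x)) S"
  using assms(2,3)
proof (induction k arbitrary: f g)
  case 0
  then show ?case by (auto intro: continuous_intros)
next
  case (Suc k)
  show ?case
    by (rule Ck_on_SucI[OF assms(1) has_derivative_Pair])
      (use Suc in \<open>auto simp: frechet_derivative_works\<close>)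
qed

section \<open>Smoothness on sets that need not be open\<close>

lemma smooth_on_cong:
  assumes "smooth_on S f" "\<And>x. x \<in> S \<Longrightarrow> f x = g x"
  shows "smooth_on S g"
  using assms unfolding smooth_on_def by (metis IntD1)

lemma Ck_on_imp_smooth_on: "(\<And>k. Ck_on k f UNIV) \<Longrightarrow> smooth_on S f"
  unfolding smooth_on_def by blast

text \<open>Because \<open>r\<close> is smooth on the whole space, the preimage of \<open>W\<close>
  is open there and a local extension of \<open>f\<close> pulls back to one of the composite, also
  at boundary points of \<open>S\<close>.\<close>

lemma smooth_on_compose:
  fixes r :: "'a::real_normed_vector \<Rightarrow> 'b::euclidean_space"
  assumes f: "smooth_on T f" and r: "\<And>k. Ck_on k r UNIV" and rS: "r ` S \<subseteq> T"
  shows "smooth_on S (\<lambda>x. f (r x))"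
  unfolding smooth_on_def
proof
  fix x assume x: "x \<in> S"
  with rS have "r x \<in> T" by blast
  with f obtain W F where W: "open W" "r x \<in> W" and F: "\<forall>k. Ck_on k F W" "\<forall>y\<in>T \<inter> W. F y = f y"
    unfolding smooth_on_def by meson
  have "open (r -` W)" using r[of 0] W(1) by (auto intro: open_vimage)
  moreover have "Ck_on k (\<lambda>y. F (r y)) (r -` W)" for k
    by (rule Ck_on_compose[OF calculation W(1)]) (use F in \<open>auto intro: Ck_on_subset[OF r]\<close>)
  moreover have "\<forall>y\<in>S \<inter> r -` W. F (r y) = f (r y)" using F(2) rS by blast
  ultimately show "\<exists>W F. open W \<and> x \<in> W \<and> (\<forall>k. Ck_on k F W) \<and> (\<forall>y\<in>S \<inter> W. F y = f (r y))"
    using W(2) by (intro exI[of _ "r -` W"] exI[of _ "\<lambda>y. F (r y)"]) auto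
qed

lemma smooth_on_mult:
  fixes f g :: "'a::real_normed_vector \<Rightarrow> real"
  assumes "smooth_on S f" "smooth_on S g"
  shows "smooth_on S (\<lambda>x. f x * g x)"
  unfolding smooth_on_def
proof
  fix x assume x: "x \<in> S"
  obtain V F where V: "open V" "x \<in> V" "\<forall>k. Ck_on k F V" "\<forall>y\<in>S \<inter> V. F y = f y"
    using assms(1) x unfolding smooth_on_def by meson
  obtain W G where W: "open W" "x \<in> W" "\<forall>k. Ck_on k G W" "\<forall>y\<in>S \<inter> W. G y = g y"
    using assms(2) x unfolding smooth_on_def by meson
  have "Ck_on k (\<lambda>x. F x * G x) (V \<inter> W)" for k
    by (intro Ck_on_mult) (use V W in \<open>auto intro: Ck_on_subset\<close>)
  then show "\<exists>W H. open W \<and> x \<in> W \<and> (\<forall>k. Ck_on k H W) \<and> (\<forall>y\<in>S \<inter> W. H y = f y * g y)"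
    using V W by (intro exI[of _ "V \<inter> W"] exI[of _ "\<lambda>x. F x * G x"]) auto
qed

lemma smooth_on_cmult:
  fixes f :: "'a::real_normed_vector \<Rightarrow> real"
  shows "smooth_on S f \<Longrightarrow> smooth_on S (\<lambda>x. a * f x)"
  by (rule smooth_on_mult[OF Ck_on_imp_smooth_on[OF Ck_on_const]])

lemma smooth_on_imp_continuous_on:
  assumes "smooth_on S f"
  shows "continuous_on S f"
  unfolding continuous_on_def
proof
  fix x assume x: "x \<in> S"
  obtain W F where W: "open W" "x \<in> W" "\<forall>k. Ck_on k F W" "\<forall>y\<in>S \<inter> W. F y = f y"
    using assms x unfolding smooth_on_def by meson
  have "continuous_on W F" using W(3)[rule_format, of 0] by simp
  then have "(F \<longlongrightarrow> F x) (at x within S)"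
    using W(1,2) continuous_on_eq_continuous_at continuous_within_subset[of x UNIV F S]
    by (auto simp: continuous_within)
  moreover have "eventually (\<lambda>y. F y = f y) (at x within S)"
    using W by (auto simp: eventually_at_topological)
  ultimately show "(f \<longlongrightarrow> f x) (at x within S)"
    using Lim_transform_eventually W x by fastforce
qed

lemma smooth_on_imp_differentiable:
  assumes "smooth_on S f" "open S" "x \<in> S"
  shows "f differentiable (at x)"
proof -
  obtain W F where W: "open W" "x \<in> W" "\<forall>k. Ck_on k F W" "\<forall>y\<in>S \<inter> W. F y = f y"
    using assms unfolding smooth_on_def by meson
  have "F differentiable (at x)" using W(3)[rule_format, of 1] W(2) by simp
  then show ?thesis
    using differentiable_cong_open[of "S \<inter> W" x F f] W assms by auto
qed

lemma has_derivative_smooth_on: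
  "smooth_on S f \<Longrightarrow> open S \<Longrightarrow> x \<in> S \<Longrightarrow> (f has_derivative frechet_derivative f (at x)) (at x)"
  using smooth_on_imp_differentiable frechet_derivative_works by blast

section \<open>Reparametrisations of the unit interval\<close>

text \<open>The classical flat function exp(-1/x) is the case m = 0. The powers are included because
  the derivative of a member is a combination of the members m + 1 and m + 2, so that one induction
  treats all orders of differentiation.\<close>

definition flat_exp :: "nat \<Rightarrow> real \<Rightarrow> real" where
  "flat_exp m x = (if x > 0 then inverse x ^ m * exp (- inverse x) else 0)"

lemma flat_exp_tendsto_0: "(flat_exp m \<longlongrightarrow> 0) (at 0)"
proof -
  have "((\<lambda>x. inverse x ^ m * exp (- inverse x)) \<longlongrightarrow> (0::real)) (at_right 0)"
    using filterlim_compose[OF tendsto_power_div_exp_0 filterlim_inverse_at_top_right, of m]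
    by (simp add: exp_minus field_simps)
  then have "(flat_exp m \<longlongrightarrow> 0) (at_right 0)"
    by (rule Lim_transform_eventually) (simp add: flat_exp_def eventually_at_filter)
  moreover have "(flat_exp m \<longlongrightarrow> 0) (at_left 0)"
    by (rule tendsto_eventually) (simp add: flat_exp_def eventually_at_filter)
  ultimately show ?thesis by (simp add: filterlim_split_at)
qed

lemma flat_exp_has_derivative:
  "(flat_exp m has_real_derivative (flat_exp (m + 2) x - real m * flat_exp (m + 1) x)) (at x)"
proof -
  consider "x > 0" | "x < 0" | "x = 0" by linarith
  then show ?thesis
  proof cases
    case 1
    have "((\<lambda>x. inverse x ^ m * exp (- inverse x)) has_real_derivative
        (flat_exp (m + 2) x - real m * flat_exp (m + 1) x)) (at x)"
      using 1 by (cases m) (auto intro!: derivative_eq_intros simp: flat_exp_def algebra_simps,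
        metis Suc_pred neq0_conv power_Suc One_nat_def)
    then show ?thesis
      by (rule has_field_derivative_transform_within_open[of _ _ _ "{0<..}"])
        (use 1 in \<open>auto simp: flat_exp_def\<close>)
  next
    case 2
    have "((\<lambda>x. 0) has_real_derivative (flat_exp (m + 2) x - real m * flat_exp (m + 1) x)) (at x)"
      using 2 by (simp add: flat_exp_def)
    then show ?thesis
      by (rule has_field_derivative_transform_within_open[of _ _ _ "{..<0}"])
        (use 2 in \<open>auto simp: flat_exp_def\<close>)
  next
    case 3
    \<comment> \<open>The difference quotient at 0 is the next member of the family, so its limit 0
      is the derivative.\<close>
    have "(\<lambda>y. (flat_exp m y - flat_exp m 0) / (y - 0)) = flat_exp (m + 1)"
      by (auto simp: flat_exp_def fun_eq_iff field_simps)
    then have "(flat_exp m has_real_derivative 0) (at 0)"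
      using flat_exp_tendsto_0[of "m + 1"] by (simp add: has_field_derivative_iff)
    then show ?thesis using 3 by (simp add: flat_exp_def)
  qed
qed

lemma Ck_on_flat_exp: "Ck_on k (flat_exp m) UNIV"
proof (induction k arbitrary: m)
  case 0
  then show ?case
    by (auto intro!: continuous_at_imp_continuous_on DERIV_isCont[OF flat_exp_has_derivative])
next
  case (Suc k)
  show ?case
  proof (rule Ck_on_SucI[OF open_UNIV])
    show "(flat_exp m has_derivative (\<lambda>v. (flat_exp (m + 2) x + (- real m) * flat_exp (m + 1) x) * v)) (at x)" for x
      using flat_exp_has_derivative[of m x] by (simp add: has_field_derivative_def)
    show "Ck_on k (\<lambda>x. (flat_exp (m + 2) x + (- real m) * flat_exp (m + 1) x) * v) UNIV" for v
      by (intro Ck_on_mult Ck_on_add Ck_on_const open_UNIV Suc.IH)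
  qed
qed

lemma Ck_on_affine: "Ck_on k (\<lambda>x::real. a + x * b) UNIV"
  by (intro Ck_on_add Ck_on_mult Ck_on_const open_UNIV Ck_on_bounded_linear[OF bounded_linear_ident])

lemma smooth_step_exists:
  obtains s :: "real \<Rightarrow> real"
  where "\<And>k. Ck_on k s UNIV" "\<And>x. x \<le> 0 \<Longrightarrow> s x = 0" "\<And>x. x \<ge> 1 \<Longrightarrow> s x = 1" "\<And>x. s x \<in> {0..1}"
proof
  define f where "f = flat_exp 0"
  \<comment> \<open>The denominator never vanishes, because x and 1 - x are not both nonpositive.
    The spelling 1 + x * (-1) matches \<open>Ck_on_affine\<close>.\<close>
  let ?q = "\<lambda>x. f x + f (1 + x * (-1))"
  define s where "s = (\<lambda>x. f x * inverse (?q x))"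
  have f: "f x \<ge> 0" "x > 0 \<Longrightarrow> f x > 0" "x \<le> 0 \<Longrightarrow> f x = 0" for x
    by (auto simp: f_def flat_exp_def)
  have q: "?q x > 0" for x
    by (cases "x > 0") (use f[of x] f[of "1 - x"] in auto)
  have Ckf: "Ck_on k f UNIV" for k unfolding f_def by (rule Ck_on_flat_exp)
  have Ckq: "Ck_on k ?q UNIV" for k
    by (intro Ck_on_add Ckf open_UNIV Ck_on_compose[OF _ _ _ Ckf] Ck_on_affine) auto
  have "Ck_on k (\<lambda>x. inverse (?q x)) UNIV" for k
    by (rule Ck_on_compose[OF _ _ _ Ck_on_inverse Ckq]) (use q in \<open>auto simp: less_le\<close>)
  then show "Ck_on k s UNIV" for k
    unfolding s_def by (intro Ck_on_mult Ckf open_UNIV)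
  show "s x = 0" if "x \<le> 0" for x using f(3)[OF that] by (simp add: s_def)
  show "s x = 1" if "x \<ge> 1" for x using f(3)[of "1 - x"] f(2)[of x] that by (simp add: s_def)
  show "s x \<in> {0..1}" for x
    using q[of x] f(1)[of x] f(1)[of "1 - x"] by (simp add: s_def field_simps)
qed

lemma Ck_on_imp_DERIV:
  fixes f :: "real \<Rightarrow> real"
  assumes "\<And>k. Ck_on k f UNIV"
  shows "(f has_real_derivative deriv f x) (at x)" "Ck_on k (deriv f) UNIV"
proof -
  have f: "Ck_on (Suc k) f UNIV" for k by (rule assms)
  have d: "f differentiable (at x)" for x using f[of 0] by simp
  then show "(f has_real_derivative deriv f x) (at x)"
    by (simp add: DERIV_deriv_iff_real_differentiable)
  have "frechet_derivative f (at x) 1 = deriv f x" for x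
  proof -
    have "(f has_derivative (*) (deriv f x)) (at x)"
      using d[of x] by (simp add: DERIV_deriv_iff_real_differentiable flip: has_field_derivative_def)
    from frechet_derivative_at[OF this] show ?thesis by (metis mult.right_neutral)
  qed
  moreover have "Ck_on k (\<lambda>x. frechet_derivative f (at x) 1) UNIV" using f[of k] by simp
  ultimately show "Ck_on k (deriv f) UNIV" by simp
qed

text \<open>\<open>C\<close> is a separate parameter because it is fixed before
  \<open>\<delta>\<close> is chosen. Constancy is demanded also outside [0,1], so that the two-sided
  derivative vanishes at the times 0 and 1 themselves.\<close>

definition flat_reparam :: "real \<Rightarrow> real \<Rightarrow> (real \<Rightarrow> real) \<Rightarrow> bool" where
  "flat_reparam C \<delta> \<xi> \<longleftrightarrow> (\<forall>k. Ck_on k \<xi> UNIV) \<and> (\<forall>t\<in>{0..1}. \<xi> t \<in> {0..1}) \<and>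
     (\<forall>t\<le>\<delta>. \<xi> t = 0) \<and> (\<forall>t\<ge>1-\<delta>. \<xi> t = 1) \<and> (\<forall>t\<in>{2*\<delta>..1-2*\<delta>}. \<xi> t = t) \<and>
     (\<forall>t\<in>{0..1}. \<bar>\<xi> t - t\<bar> \<le> 2 * \<delta>) \<and> (\<forall>t. \<bar>deriv \<xi> t\<bar> \<le> C)"

lemma flat_reparamD:
  assumes "flat_reparam C \<delta> \<xi>"
  shows "Ck_on k \<xi> UNIV" "t \<in> {0..1} \<Longrightarrow> \<xi> t \<in> {0..1}" "t \<le> \<delta> \<Longrightarrow> \<xi> t = 0" "t \<ge> 1 - \<delta> \<Longrightarrow> \<xi> t = 1"
    "t \<in> {2*\<delta>..1-2*\<delta>} \<Longrightarrow> \<xi> t = t" "t \<in> {0..1} \<Longrightarrow> \<bar>\<xi> t - t\<bar> \<le> 2 * \<delta>" "\<bar>deriv \<xi> t\<bar> \<le> C"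
  using assms unfolding flat_reparam_def by blast+

text \<open>With \<open>s\<close> a smooth function vanishing for \<open>x \<le> 1\<close> and equal to \<open>x\<close> for \<open>x \<ge> 2\<close>, the
  reparametrisation is \<open>\<delta> s (t / \<delta>)\<close> near \<open>0\<close> and \<open>1 - \<delta> s ((1 - t) / \<delta>)\<close> near \<open>1\<close>; scaling keeps
  its derivative bounded independently of \<open>\<delta>\<close>.\<close>

lemma flat_reparam_exists:
  "\<exists>C\<ge>0. \<forall>\<delta>. 0 < \<delta> \<and> \<delta> < 1/4 \<longrightarrow> (\<exists>\<xi>. flat_reparam C \<delta> \<xi>)"
proof -
  obtain \<sigma> :: "real \<Rightarrow> real" where \<sigma>: "\<And>k. Ck_on k \<sigma> UNIV" "\<And>x. x \<le> 0 \<Longrightarrow> \<sigma> x = 0"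
    "\<And>x. x \<ge> 1 \<Longrightarrow> \<sigma> x = 1" "\<And>x. \<sigma> x \<in> {0..1}"
    using smooth_step_exists by metis
  \<comment> \<open>The factor switches the identity on between 1 and 2. As it lies in [0,1], also 0
    <= s x <= x for x >= 0, which later bounds the displacement \<open>\<xi> t - t\<close> near the
    end points.\<close>
  define s where "s = (\<lambda>x. x * \<sigma> (-1 + x * 1))"
  have Cks: "Ck_on k s UNIV" for k unfolding s_def
    by (intro Ck_on_mult open_UNIV Ck_on_bounded_linear[OF bounded_linear_ident]
        Ck_on_compose[OF _ _ _ \<sigma>(1)] Ck_on_affine) auto
  have s: "x \<le> 1 \<Longrightarrow> s x = 0" "x \<ge> 2 \<Longrightarrow> s x = x" "x \<ge> 0 \<Longrightarrow> s x \<in> {0..x}" for x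
    using \<sigma>(2,3,4)[of "x - 1"] by (auto simp: s_def mult_left_le)
  note Ds = Ck_on_imp_DERIV(1)[OF Cks]
  have "continuous_on {1..2} (deriv s)"
    using Ck_on_imp_DERIV(2)[OF Cks, of 0] by (auto intro: continuous_on_subset)
  then have "bounded (deriv s ` {1..2})"
    by (intro compact_imp_bounded compact_continuous_image) auto
  then obtain B where B: "\<bar>deriv s x\<bar> \<le> B" if "x \<in> {1..2}" for x
    unfolding bounded_iff by (metis imageI real_norm_def)
  \<comment> \<open>Off [1,2] the function \<open>s\<close> is locally 0 or the identity, with
    derivative 0 or 1; since B >= 0, the bound B + 1 covers these values too.\<close>
  have B': "\<bar>deriv s x\<bar> \<le> B + 1" for x
  proof -
    have "B \<ge> 0" using B[of 1] by force
    moreover have "deriv s x = 0" if "x < 1"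
    proof (rule DERIV_imp_deriv, rule has_field_derivative_transform_within_open[of "\<lambda>x. 0" _ _ "{..<1}"])
    qed (use that s(1) in auto)
    moreover have "deriv s x = 1" if "x > 2"
    proof (rule DERIV_imp_deriv, rule has_field_derivative_transform_within_open[of "\<lambda>x. x" _ _ "{2<..}"])
    qed (use that s(2) in auto)
    ultimately show ?thesis using B[of x] by (cases "x < 1"; cases "x > 2") auto
  qed
  have "\<exists>\<xi>. flat_reparam (2 * (B + 1) + 1) \<delta> \<xi>" if \<delta>: "0 < \<delta>" "\<delta> < 1/4" for \<delta>
  proof -
    \<comment> \<open>A single formula for both ends avoids gluing: for t <= 1 - 2 *
      \<open>\<delta>\<close> the last two summands cancel, and for t >= 2 * \<open>\<delta>\<close>
      the first one is t. As \<open>\<delta>\<close> < 1/4, the two ranges overlap and cover the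
      line.\<close>
    define \<xi> where "\<xi> = (\<lambda>t. \<delta> * s (0 + t * (1/\<delta>)) + (1 + t * (-1)) + (- \<delta>) * s (1/\<delta> + t * (-1/\<delta>)))"
    have \<xi>: "\<xi> t = \<delta> * s (t / \<delta>) + (1 - t) - \<delta> * s ((1 - t) / \<delta>)" for t
      by (simp add: \<xi>_def diff_divide_distrib)
    have left: "\<xi> t = \<delta> * s (t / \<delta>)" if "t \<le> 1 - 2 * \<delta>" for t
      using s(2)[of "(1 - t) / \<delta>"] that \<delta> by (simp add: \<xi> field_simps)
    have right: "\<xi> t = 1 - \<delta> * s ((1 - t) / \<delta>)" if "t \<ge> 2 * \<delta>" for t
      using s(2)[of "t / \<delta>"] that \<delta> by (simp add: \<xi> field_simps)
    have scaled: "\<delta> * s (x / \<delta>) \<in> {0..x}" if "x \<ge> 0" for x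
      using s(3)[of "x / \<delta>"] that \<delta> by (auto simp: field_simps)
    have "Ck_on k \<xi> UNIV" for k unfolding \<xi>_def
      by (intro Ck_on_mult Ck_on_add Ck_on_const open_UNIV Ck_on_compose[OF _ _ _ Cks] Ck_on_affine) auto
    moreover have id: "\<xi> t = t" if "t \<in> {2*\<delta>..1-2*\<delta>}" for t
      using left[of t] s(2)[of "t / \<delta>"] that \<delta> by (simp add: field_simps)
    moreover have "\<xi> t = 0" if "t \<le> \<delta>" for t
      using left[of t] s(1)[of "t / \<delta>"] that \<delta> by simp
    moreover have "\<xi> t = 1" if "t \<ge> 1 - \<delta>" for t
      using right[of t] s(1)[of "(1 - t) / \<delta>"] that \<delta> by simp
    moreover have "\<xi> t \<in> {0..1} \<and> \<bar>\<xi> t - t\<bar> \<le> 2 * \<delta>" if t: "t \<in> {0..1}" for t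
    proof -
      consider "t < 2 * \<delta>" | "t \<in> {2*\<delta>..1-2*\<delta>}" | "t > 1 - 2 * \<delta>" by force
      then show ?thesis
      proof cases
        case 1
        then show ?thesis using left[of t] scaled[of t] t \<delta> by auto
      next
        case 2
        then show ?thesis using id[of t] t \<delta> by auto
      next
        case 3
        then show ?thesis using right[of t] scaled[of "1 - t"] t \<delta> by auto
      qed
    qed
    moreover have "\<bar>deriv \<xi> t\<bar> \<le> 2 * (B + 1) + 1" for t
    proof -
      have affine: "((\<lambda>t. a + t * b) has_real_derivative b) (at t)" for a b :: real
        by (auto intro!: derivative_eq_intros)
      have D: "((\<lambda>t. s (a + t * b)) has_real_derivative deriv s (a + t * b) * b) (at t)" for a b
        by (rule DERIV_chain2[OF Ds affine])
      have "(\<xi> has_real_derivative \<delta> * (deriv s (0 + t * (1/\<delta>)) * (1/\<delta>)) + (-1)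
          + (-\<delta>) * (deriv s (1/\<delta> + t * (-1/\<delta>)) * (-1/\<delta>))) (at t)"
        unfolding \<xi>_def
        by (rule DERIV_add[OF DERIV_add[OF DERIV_cmult[OF D] affine] DERIV_cmult[OF D]])
      \<comment> \<open>The inner factors 1/\<open>\<delta>\<close> cancel the outer
        \<open>\<delta>\<close>. What remains is two values of the derivative of \<open>s\<close>
        and the -1 of the middle summand, whence the constant 2 * (B + 1) + 1.\<close>
      then have "deriv \<xi> t = deriv s (0 + t * (1/\<delta>)) - 1 + deriv s (1/\<delta> + t * (-1/\<delta>))"
        using \<delta> by (subst DERIV_imp_deriv) auto
      then show ?thesis
        using abs_le_D1[OF B'[of "0 + t * (1/\<delta>)"]] abs_le_D2[OF B'[of "0 + t * (1/\<delta>)"]]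
          abs_le_D1[OF B'[of "1/\<delta> + t * (-1/\<delta>)"]] abs_le_D2[OF B'[of "1/\<delta> + t * (-1/\<delta>)"]]
        by (intro abs_leI) simp_all
    qed
    ultimately show ?thesis
      unfolding flat_reparam_def by blast
  qed
  moreover have "0 \<le> 2 * (B + 1) + 1" using B'[of 0] by simp
  ultimately show ?thesis by blast
qed

section \<open>Tangent vectors and velocities\<close>

lemma atlas_chart:
  assumes "smooth_atlas A" "c \<in> A"
  shows "open (fst c)" "open (cimg c)" "continuous_on (fst c) (snd c)" "continuous_on (cimg c) (cinv c)"
    and "p \<in> fst c \<Longrightarrow> cinv c (snd c p) = p" "p \<in> fst c \<Longrightarrow> snd c p \<in> cimg c"
    and "y \<in> cimg c \<Longrightarrow> cinv c y \<in> fst c" "y \<in> cimg c \<Longrightarrow> snd c (cinv c y) = y"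
proof -
  have c: "open (fst c)" "open (cimg c)" "homeomorphism (fst c) (cimg c) (snd c) (cinv c)"
    using assms unfolding smooth_atlas_def by blast+
  then show "open (fst c)" "open (cimg c)" by blast+
  show "continuous_on (fst c) (snd c)" "continuous_on (cimg c) (cinv c)"
    using c(3) by (simp_all add: homeomorphism_def)
  show "p \<in> fst c \<Longrightarrow> cinv c (snd c p) = p"
    using c(3) by (simp add: homeomorphism_def)
  show "y \<in> cimg c \<Longrightarrow> snd c (cinv c y) = y"
    by (rule f_inv_into_f)
  show "p \<in> fst c \<Longrightarrow> snd c p \<in> cimg c" "y \<in> cimg c \<Longrightarrow> cinv c y \<in> fst c"
    by (simp_all add: inv_into_into)
qed

lemma atlas_covers:
  assumes "smooth_atlas A"
  obtains c where "c \<in> A" "p \<in> fst c"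
  using assms unfolding smooth_atlas_def by (metis UN_E UNIV_I)

lemma has_derivative_in_chart:
  assumes "smooth_atlas A" "c \<in> A" "p \<in> fst c" "smooth_fun A f"
  shows "((\<lambda>y. f (cinv c y)) has_derivative (\<lambda>v. tvec A c p v f)) (at (snd c p))"
  using has_derivative_smooth_on[of "cimg c" "\<lambda>y. f (cinv c y)" "snd c p"] assms atlas_chart[OF assms(1,2)]
  by (simp add: smooth_fun_def tvec_def)

lemma tvec_scaleR:
  assumes "smooth_atlas A" "c \<in> A" "p \<in> fst c"
  shows "tvec A c p (a *\<^sub>R v) = (\<lambda>f. a * tvec A c p v f)"
proof
  fix f
  show "tvec A c p (a *\<^sub>R v) f = a * tvec A c p v f"
  proof (cases "smooth_fun A f")
    case True
    show ?thesis
      using linear_cmul[OF has_derivative_linear[OF has_derivative_in_chart[OF assms True]], of a v] by simp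
  qed (simp add: tvec_def)
qed

text \<open>The new coordinates are the image of w under the derivative of the transition map from
  \<open>d\<close> to \<open>c\<close>. The chain rule gives equality on smooth functions, and on
  all others both derivations are 0 by convention.\<close>

lemma tvec_change_chart:
  assumes A: "smooth_atlas A" and c: "c \<in> A" "p \<in> fst c" and d: "d \<in> A" "p \<in> fst d"
  shows "\<exists>v. tvec A d p w = tvec A c p v"
proof -
  let ?T = "\<lambda>y. snd c (cinv d y)" and ?S = "snd d ` (fst d \<inter> fst c)"
  note C = atlas_chart[OF A c(1)] and D = atlas_chart[OF A d(1)]
  \<comment> \<open>This exhibits the overlap as a preimage under the continuous
    \<open>cinv d\<close>, hence as an open set, on which the transition map can be
    differentiated.\<close>
  have S: "?S = {y \<in> cimg d. cinv d y \<in> fst c}" 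
  proof (intro subset_antisym subsetI)
    fix y assume "y \<in> {y \<in> cimg d. cinv d y \<in> fst c}"
    then show "y \<in> ?S" using D(7,8)[of y] by (intro image_eqI[of y "snd d" "cinv d y"]) simp_all
  qed (use D in auto)
  have "open ?S" unfolding S
    using continuous_open_preimage[OF D(4,2) C(1)] by (simp add: vimage_def Int_def)
  moreover have "smooth_on ?S ?T" using A c d by (simp add: smooth_atlas_def)
  moreover have "snd d p \<in> ?S" using c d by auto
  ultimately have T: "(?T has_derivative frechet_derivative ?T (at (snd d p))) (at (snd d p))"
    by (intro has_derivative_smooth_on)
  have "tvec A d p w f = tvec A c p (frechet_derivative ?T (at (snd d p)) w) f" for f
  proof (cases "smooth_fun A f")
    case True
    have "?T (snd d p) = snd c p" using D d by simp
    then have "((\<lambda>y. f (cinv c y)) has_derivative (\<lambda>v. tvec A c p v f)) (at (?T (snd d p)))"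
      using has_derivative_in_chart[OF A c True] by simp
    from diff_chain_at[OF T this]
    have "((\<lambda>y. f (cinv c (?T y))) has_derivative (\<lambda>w. tvec A c p (frechet_derivative ?T (at (snd d p)) w) f)) (at (snd d p))"
      by (simp add: o_def)
    then have "((\<lambda>y. f (cinv d y)) has_derivative (\<lambda>w. tvec A c p (frechet_derivative ?T (at (snd d p)) w) f)) (at (snd d p))"
      by (rule has_derivative_transform_within_open[OF _ \<open>open ?S\<close> \<open>snd d p \<in> ?S\<close>])
        (use S C in auto)
    from has_derivative_unique[OF this has_derivative_in_chart[OF A d True]]
    show ?thesis by metis
  qed (simp add: tvec_def)
  then show ?thesis by blast
qed

lemma tangent_space_eq:
  assumes "smooth_atlas A" "c \<in> A" "p \<in> fst c"
  shows "tangent_space A p = range (tvec A c p)"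
  using assms tvec_change_chart[OF assms] unfolding tangent_space_def by blast

text \<open>Tensor fields are bilinear only through their chart components, so homogeneity on
  derivations is read off in one chart around p, and only for tangent vectors.\<close>

lemma tensor2_cmult:
  assumes A: "smooth_atlas A" and \<beta>: "smooth_tensor2 A \<beta>"
    and X: "X \<in> tangent_space A p" and Y: "Y \<in> tangent_space A p"
  shows "(\<lambda>f. a * X f) \<in> tangent_space A p"
    "\<beta> p (\<lambda>f. a * X f) Y = a * \<beta> p X Y" "\<beta> p Y (\<lambda>f. a * X f) = a * \<beta> p Y X"
proof -
  obtain c where c: "c \<in> A" "p \<in> fst c" using atlas_covers[OF A] .
  note C = atlas_chart[OF A c(1)]
  obtain v w where v: "X = tvec A c p v" and w: "Y = tvec A c p w"
    using X Y unfolding tangent_space_eq[OF A c] by blast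
  have bl: "bilinear (\<lambda>v w. comp2 A \<beta> c v w (snd c p))"
    using \<beta> c C unfolding smooth_tensor2_def by blast
  show "(\<lambda>f. a * X f) \<in> tangent_space A p"
    unfolding tangent_space_eq[OF A c] v tvec_scaleR[OF A c, symmetric] by (rule rangeI)
  show "\<beta> p (\<lambda>f. a * X f) Y = a * \<beta> p X Y" "\<beta> p Y (\<lambda>f. a * X f) = a * \<beta> p Y X"
    using bilinear_lmul[OF bl, of a v w] bilinear_rmul[OF bl, of w a v] C(5)[OF c(2)]
    by (simp_all add: comp2_def v w tvec_scaleR[OF A c])
qed

section \<open>Velocities of curves, in charts and as derivations\<close>

text \<open>The neighbourhood clause keeps the curve inside the chart domain, outside of which the
  values of \<open>snd c\<close> are arbitrary. The derivative is taken within [0,1] to agree with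
  \<open>curve_velocity\<close>.\<close>

definition chart_velocity :: "('m::t2_space, 'n::finite) chart \<Rightarrow> (real \<Rightarrow> 'm) \<Rightarrow> real \<Rightarrow> real^'n \<Rightarrow> bool" where
  "chart_velocity c \<gamma> t v \<longleftrightarrow> (\<exists>N. open N \<and> t \<in> N \<and> (\<forall>s\<in>N \<inter> {0..1}. \<gamma> s \<in> fst c)) \<and>
     ((\<lambda>s. snd c (\<gamma> s)) has_vector_derivative v) (at t within {0..1})"

lemma curve_velocity_eq_tvec:
  assumes A: "smooth_atlas A" and c: "c \<in> A" and t: "t \<in> {0..1}" and v: "chart_velocity c \<gamma> t v"
  shows "curve_velocity A {0..1} \<gamma> t = tvec A c (\<gamma> t) v"
proof
  fix f
  obtain N where N: "open N" "t \<in> N" "\<forall>s\<in>N \<inter> {0..1}. \<gamma> s \<in> fst c"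
    using v unfolding chart_velocity_def by blast
  then have p: "\<gamma> t \<in> fst c" using t by blast
  show "curve_velocity A {0..1} \<gamma> t f = tvec A c (\<gamma> t) v f"
  proof (cases "smooth_fun A f")
    case True
    note D = has_derivative_in_chart[OF A c p True]
    have "((\<lambda>s. f (cinv c (snd c (\<gamma> s)))) has_derivative (\<lambda>h. tvec A c (\<gamma> t) (h *\<^sub>R v) f)) (at t within {0..1})"
      using diff_chain_within[of "\<lambda>s. snd c (\<gamma> s)" "\<lambda>h. h *\<^sub>R v" t "{0..1}" "\<lambda>y. f (cinv c y)"
          "\<lambda>v. tvec A c (\<gamma> t) v f", OF _ has_derivative_at_withinI[OF D]] v
      unfolding chart_velocity_def has_vector_derivative_def by (simp add: o_def)
    then have "((\<lambda>s. f (cinv c (snd c (\<gamma> s)))) has_vector_derivative tvec A c (\<gamma> t) v f) (at t within {0..1})"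
      by (simp add: has_vector_derivative_def tvec_scaleR[OF A c p])
    then have "((\<lambda>s. f (\<gamma> s)) has_vector_derivative tvec A c (\<gamma> t) v f) (at t within {0..1})"
      unfolding has_vector_derivative_def
    proof (rule has_derivative_transform_eventually)
      show "eventually (\<lambda>s. f (cinv c (snd c (\<gamma> s))) = f (\<gamma> s)) (at t within {0..1})"
        using N atlas_chart(5)[OF A c] by (auto simp: eventually_at_topological)
    qed (use t p atlas_chart(5)[OF A c] in auto)
    from vector_derivative_within_closed_interval[OF _ t this]
    show ?thesis using True by (simp add: curve_velocity_def)
  qed (simp add: curve_velocity_def tvec_def)
qed

lemma chart_velocity_compose:
  fixes r :: "real \<Rightarrow> real"
  assumes v: "chart_velocity c \<gamma> (r t) v" and r: "continuous_on UNIV r" "(r has_real_derivative r') (at t)"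
    and r01: "\<And>s. s \<in> {0..1} \<Longrightarrow> r s \<in> {0..1}"
  shows "chart_velocity c (\<lambda>s. \<gamma> (r s)) t (r' *\<^sub>R v)"
proof -
  obtain N where N: "open N" "r t \<in> N" "\<forall>s\<in>N \<inter> {0..1}. \<gamma> s \<in> fst c"
    using v unfolding chart_velocity_def by blast
  have "open (r -` N)" using r(1) N(1) by (auto intro: open_vimage)
  then have 1: "\<exists>N. open N \<and> t \<in> N \<and> (\<forall>s\<in>N \<inter> {0..1}. \<gamma> (r s) \<in> fst c)"
    using N r01 by (intro exI[of _ "r -` N"]) auto
  \<comment> \<open>The derivative of the curve is needed only along times attained by
    \<open>r\<close>, all of them in [0,1]; this keeps the chain rule valid at end points.\<close>
  have "((\<lambda>s. snd c (\<gamma> s)) has_vector_derivative v) (at (r t) within r ` {0..1})"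
    using v r01 unfolding chart_velocity_def by (auto intro: has_vector_derivative_within_subset)
  moreover have "(r has_vector_derivative r') (at t within {0..1})"
    using r(2) has_field_derivative_at_within has_real_derivative_iff_has_vector_derivative by blast
  ultimately have "((\<lambda>s. snd c (\<gamma> (r s))) has_vector_derivative r' *\<^sub>R v) (at t within {0..1})"
    using vector_diff_chain_within[of r r' t "{0..1}" "\<lambda>s. snd c (\<gamma> s)" v] by (simp add: o_def)
  with 1 show ?thesis unfolding chart_velocity_def by blast
qed

text \<open>The velocity is read off from a smooth local extension \<open>F\<close> of the family in
  charts. This makes it jointly continuous in time and point, as the compactness argument for the
  speed requires. \<open>F\<close> agrees with the family only for times in [0,1], which suffices
  for derivatives within that interval.\<close>

lemma map_family_chart_velocity:
  fixes \<Phi> :: "real \<Rightarrow> 'm::t2_space \<Rightarrow> 'm"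
  assumes A: "smooth_atlas A" and \<Phi>: "smooth_map_family A \<Phi>" and t0: "t0 \<in> {0..1}"
    and d: "d \<in> A" "\<Phi> t0 x0 \<in> fst d"
  obtains W w where "open W" "(t0, x0) \<in> W" "continuous_on W w"
    "\<And>t x. (t, x) \<in> W \<Longrightarrow> t \<in> {0..1} \<Longrightarrow> \<Phi> t x \<in> fst d \<and> chart_velocity d (\<lambda>s. \<Phi> s x) t (w (t, x))"
proof -
  obtain c where c: "c \<in> A" "x0 \<in> fst c" using atlas_covers[OF A] .
  note C = atlas_chart[OF A c(1)] and D = atlas_chart[OF A d(1)]
  let ?S = "{(t, y). t \<in> {0..1} \<and> y \<in> cimg c \<and> \<Phi> t (cinv c y) \<in> fst d}"
  have "smooth_on ?S (\<lambda>(t, y). snd d (\<Phi> t (cinv c y)))"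
    using \<Phi> c d unfolding smooth_map_family_def by blast
  moreover have "(t0, snd c x0) \<in> ?S" using t0 c C d by auto
  ultimately obtain W F where W: "open W" "(t0, snd c x0) \<in> W" and F: "\<forall>k. Ck_on k F W"
      "\<forall>y\<in>?S \<inter> W. F y = (\<lambda>(t, y). snd d (\<Phi> t (cinv c y))) y"
    unfolding smooth_on_def by meson
  have "continuous_on ({0..1} \<times> UNIV) (\<lambda>(t, x). \<Phi> t x)" using \<Phi> unfolding smooth_map_family_def by blast
  then obtain W1 where W1: "open W1" "W1 \<inter> ({0..1} \<times> UNIV) = (\<lambda>(t, x). \<Phi> t x) -` fst d \<inter> ({0..1} \<times> UNIV)"
    using D(1) by (auto simp: continuous_on_open_invariant)
  let ?r = "\<lambda>z. (fst z, snd c (snd z))" and ?U = "UNIV \<times> fst c :: (real \<times> 'm) set"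
  have r: "continuous_on ?U ?r"
    by (intro continuous_on_Pair continuous_on_fst continuous_on_id continuous_on_compose2[OF C(3) continuous_on_snd[OF continuous_on_id]]) auto
  have U: "open ?U" using C(1) by (simp add: open_Times)
  define V where "V = W1 \<inter> (?U \<inter> ?r -` W)"
  define w where "w = (\<lambda>z. frechet_derivative F (at (?r z)) (1, 0))"
  have "open (?r -` W \<inter> ?U)" using W(1) r continuous_on_open_vimage[OF U] by blast
  then have "open V" unfolding V_def using W1 by (simp add: open_Int Int_commute)
  show ?thesis
  proof
    show "open V" by fact
    show "(t0, x0) \<in> V" using W1 W d t0 c unfolding V_def by auto
    have "continuous_on W (\<lambda>y. frechet_derivative F (at y) (1, 0))"
      using F(1)[rule_format, of 1] by simp
    then show "continuous_on V w" unfolding w_def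
      by (rule continuous_on_compose2) (auto simp: V_def intro: continuous_on_subset[OF r])
  next
    fix t x assume tx: "(t, x) \<in> V" "t \<in> {0..1}"
    have in_d: "\<Phi> s x \<in> fst d" if "(s, x) \<in> V" "s \<in> {0..1}" for s
      using W1 that unfolding V_def by auto
    define N where "N = (\<lambda>s. (s, x)) -` V"
    have N: "open N" unfolding N_def using \<open>open V\<close> by (intro open_vimage continuous_intros)
    have tN: "t \<in> N" using tx by (simp add: N_def)
    have "F differentiable (at (t, snd c x))"
      using F(1)[rule_format, of 1] tx by (simp add: V_def)
    then have "(F has_derivative frechet_derivative F (at (t, snd c x))) (at (t, snd c x))"
      using frechet_derivative_works by blast
    moreover have "((\<lambda>s. (s, snd c x)) has_derivative (\<lambda>h. (h, 0))) (at t within {0..1})"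
      by (auto intro!: derivative_eq_intros)
    ultimately have "((\<lambda>s. F (s, snd c x)) has_derivative (\<lambda>h. frechet_derivative F (at (t, snd c x)) (h, 0))) (at t within {0..1})"
      using diff_chain_within[of "\<lambda>s. (s, snd c x)" "\<lambda>h. (h, 0)" t "{0..1}" F "frechet_derivative F (at (t, snd c x))"]
      by (auto simp: o_def intro: has_derivative_at_withinI)
    moreover have "frechet_derivative F (at (t, snd c x)) (h, 0) = h *\<^sub>R w (t, x)" for h
      using linear_cmul[OF linear_frechet_derivative[OF \<open>F differentiable (at (t, snd c x))\<close>], of h "(1, 0)"]
      by (simp add: w_def)
    ultimately have "((\<lambda>s. F (s, snd c x)) has_vector_derivative w (t, x)) (at t within {0..1})"
      by (simp add: has_vector_derivative_def)
    moreover have F_eq: "F (s, snd c x) = snd d (\<Phi> s x)" if "s \<in> N" "s \<in> {0..1}" for s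
    proof -
      have "(s, x) \<in> V" using that by (simp add: N_def)
      then have "(s, snd c x) \<in> ?S \<inter> W" "x \<in> fst c" using in_d[of s] that C(5,6) by (auto simp: V_def)
      with F(2) C(5) show ?thesis by fastforce
    qed
    ultimately have "((\<lambda>s. snd d (\<Phi> s x)) has_vector_derivative w (t, x)) (at t within {0..1})"
      unfolding has_vector_derivative_def
      by (elim has_derivative_transform_eventually)
        (use N tN tx in \<open>auto simp: eventually_at_topological\<close>)
    then show "\<Phi> t x \<in> fst d \<and> chart_velocity d (\<lambda>s. \<Phi> s x) t (w (t, x))"
      using in_d tx N tN unfolding chart_velocity_def N_def by auto
  qed
qed

lemma map_family_velocity:
  fixes \<Phi> :: "real \<Rightarrow> 'm::t2_space \<Rightarrow> 'm"
  assumes A: "smooth_atlas A" and \<Phi>: "smooth_map_family A \<Phi>" and t: "t \<in> {0..1}"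
  shows "curve_velocity A {0..1} (\<lambda>s. \<Phi> s x) t \<in> tangent_space A (\<Phi> t x)"
proof -
  obtain d where d: "d \<in> A" "\<Phi> t x \<in> fst d" using atlas_covers[OF A] .
  obtain v where "chart_velocity d (\<lambda>s. \<Phi> s x) t v"
    using map_family_chart_velocity[OF A \<Phi> t d] t by metis
  then show ?thesis
    using curve_velocity_eq_tvec[OF A d(1) t] d by (auto simp: tangent_space_def)
qed

lemma map_family_velocity_compose:
  fixes \<Phi> :: "real \<Rightarrow> 'm::t2_space \<Rightarrow> 'm"
  assumes A: "smooth_atlas A" and \<Phi>: "smooth_map_family A \<Phi>" and t: "t \<in> {0..1}"
    and r: "continuous_on UNIV r" "(r has_real_derivative r') (at t)" "\<And>s. s \<in> {0..1} \<Longrightarrow> r s \<in> {0..1}"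
  shows "curve_velocity A {0..1} (\<lambda>s. \<Phi> (r s) x) t = (\<lambda>f. r' * curve_velocity A {0..1} (\<lambda>s. \<Phi> s x) (r t) f)"
proof -
  have rt: "r t \<in> {0..1}" using t r(3) by blast
  obtain d where d: "d \<in> A" "\<Phi> (r t) x \<in> fst d" using atlas_covers[OF A] .
  obtain v where v: "chart_velocity d (\<lambda>s. \<Phi> s x) (r t) v"
    using map_family_chart_velocity[OF A \<Phi> rt d] rt by metis
  show ?thesis
    using curve_velocity_eq_tvec[OF A d(1) rt v]
      curve_velocity_eq_tvec[OF A d(1) t chart_velocity_compose[OF v r]] tvec_scaleR[OF A d]
    by simp
qed

section \<open>Scaling forms\<close>

lemma tvec_in_tangent_space: "c \<in> A \<Longrightarrow> p \<in> fst c \<Longrightarrow> tvec A c p v \<in> tangent_space A p"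
  unfolding tangent_space_def by blast

text \<open>The two forms are compared on tangent vectors only, since
  \<open>contraction_reparam\<close> yields no more and chart components see nothing else.\<close>

lemma smooth_form1_scale:
  assumes A: "smooth_atlas A" and \<alpha>: "smooth_form1 A \<alpha>"
    and \<beta>: "\<And>p X. X \<in> tangent_space A p \<Longrightarrow> \<beta> p X = a * \<alpha> p X"
  shows "smooth_form1 A \<beta>"
  unfolding smooth_form1_def
proof (intro ballI conjI allI)
  fix c assume c: "c \<in> A"
  note C = atlas_chart[OF A c]
  have eq: "comp1 A \<beta> c v y = a * comp1 A \<alpha> c v y" if "y \<in> cimg c" for v y
    unfolding comp1_def using C(7)[OF that] by (intro \<beta> tvec_in_tangent_space c)
  show "linear (\<lambda>v. comp1 A \<beta> c v y)" if y: "y \<in> cimg c" for y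
  proof -
    have "linear (\<lambda>v. comp1 A \<alpha> c v y)" using \<alpha> c y unfolding smooth_form1_def by blast
    from linear_compose_scale_right[OF this, of a] show ?thesis by (simp add: eq[OF y])
  qed
  show "smooth_on (cimg c) (comp1 A \<beta> c v)" for v
    by (rule smooth_on_cong[OF smooth_on_cmult[of _ _ a]])
      (use \<alpha> c eq in \<open>auto simp: smooth_form1_def\<close>)
qed

lemma is_d1_scale:
  assumes A: "smooth_atlas A" and \<alpha>: "smooth_form1 A \<alpha>" and d: "is_d1 A \<alpha> \<theta>"
    and \<beta>: "\<And>p X. X \<in> tangent_space A p \<Longrightarrow> \<beta> p X = a * \<alpha> p X"
  shows "is_d1 A \<beta> (\<lambda>p X Y. a * \<theta> p X Y)"
  unfolding is_d1_def
proof (intro ballI allI)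
  fix c y v w assume c: "c \<in> A" and y: "y \<in> cimg c"
  note C = atlas_chart[OF A c]
  have eq: "a * comp1 A \<alpha> c v y = comp1 A \<beta> c v y" if "y \<in> cimg c" for v y
    unfolding comp1_def using C(7)[OF that] by (intro \<beta>[symmetric] tvec_in_tangent_space c)
  have D: "frechet_derivative (comp1 A \<beta> c v) (at y) = (\<lambda>w. a * frechet_derivative (comp1 A \<alpha> c v) (at y) w)" for v
  proof -
    have "smooth_on (cimg c) (comp1 A \<alpha> c v)" using \<alpha> c unfolding smooth_form1_def by blast
    from has_derivative_mult_right[OF has_derivative_smooth_on[OF this C(2) y], of a]
    have "(comp1 A \<beta> c v has_derivative (\<lambda>w. a * frechet_derivative (comp1 A \<alpha> c v) (at y) w)) (at y)"
      by (rule has_derivative_transform_within_open[OF _ C(2) y eq])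
    from frechet_derivative_at[OF this] show ?thesis by simp
  qed
  have "comp2 A \<theta> c v w y = frechet_derivative (comp1 A \<alpha> c w) (at y) v - frechet_derivative (comp1 A \<alpha> c v) (at y) w"
    using d c y unfolding is_d1_def by blast
  then show "comp2 A (\<lambda>p X Y. a * \<theta> p X Y) c v w y =
      frechet_derivative (comp1 A \<beta> c w) (at y) v - frechet_derivative (comp1 A \<beta> c v) (at y) w"
    unfolding D by (simp add: comp2_def right_diff_distrib)
qed

lemma closed_form1_scale:
  assumes "smooth_atlas A" "closed_form1 A \<alpha>"
    and "\<And>p X. X \<in> tangent_space A p \<Longrightarrow> \<beta> p X = a * \<alpha> p X"
  shows "closed_form1 A \<beta>"
  using smooth_form1_scale[OF assms(1) _ assms(3)] is_d1_scale[OF assms(1) _ _ assms(3)] assms(2)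
  unfolding closed_form1_def by fastforce

lemma smooth_form2_scale:
  fixes \<theta> :: "'m::t2_space form2"
  assumes "smooth_form2 A \<theta>"
  shows "smooth_form2 A (\<lambda>p X Y. a * \<theta> p X Y)"
  unfolding smooth_form2_def smooth_tensor2_def
proof (intro ballI conjI allI)
  fix c assume c: "c \<in> A"
  have eq: "comp2 A (\<lambda>p X Y. a * \<theta> p X Y) c v w = (\<lambda>y. a * comp2 A \<theta> c v w y)" for v w
    by (simp add: comp2_def fun_eq_iff)
  show "bilinear (\<lambda>v w. comp2 A (\<lambda>p X Y. a * \<theta> p X Y) c v w y)" if "y \<in> cimg c" for y
    using assms c that linear_compose_scale_right[of _ a]
    unfolding eq smooth_form2_def smooth_tensor2_def bilinear_def by fastforce
  show "smooth_on (cimg c) (comp2 A (\<lambda>p X Y. a * \<theta> p X Y) c v w)" for v w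
    unfolding eq using assms c by (intro smooth_on_cmult) (auto simp: smooth_form2_def smooth_tensor2_def)
qed (use assms in \<open>auto simp: smooth_form2_def\<close>)

lemma smooth_fun_cmult_derivation:
  assumes A: "smooth_atlas A" and u: "smooth_fun A u" and X: "X \<in> tangent_space A p"
  shows "X (\<lambda>p. a * u p) = a * X u"
proof -
  obtain c v where c: "c \<in> A" "p \<in> fst c" and v: "X = tvec A c p v"
    using X unfolding tangent_space_def by blast
  have "smooth_fun A (\<lambda>p. a * u p)" using u smooth_on_cmult unfolding smooth_fun_def by blast
  from has_derivative_unique[OF has_derivative_in_chart[OF A c this]
      has_derivative_mult_right[OF has_derivative_in_chart[OF A c u], of a]]
  show ?thesis unfolding v by metis
qed

text \<open>All witnesses scale by \<open>a\<close>. The orthonormal basis chosen in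
  \<open>inner1\<close> and \<open>inner2\<close> depends on the metric and the point only, so it is
  the same before and after scaling; constants leave the integral without any integrability
  condition.\<close>

lemma harmonic1_scale:
  fixes \<alpha> :: "'m::t2_space form1"
  assumes A: "smooth_atlas A" and \<alpha>: "harmonic1 A g \<alpha>"
  shows "harmonic1 A g (\<lambda>p X. a * \<alpha> p X)"
proof -
  obtain u \<beta> \<gamma> where sm: "smooth_form1 A \<alpha>" and u: "is_codiff1 A g \<alpha> u" and \<beta>: "smooth_form2 A \<beta>"
    and d: "is_d1 A \<alpha> \<beta>" and \<gamma>: "is_codiff2 A g \<beta> \<gamma>"
    and 0: "\<And>p X. X \<in> tangent_space A p \<Longrightarrow> d_fun u p X + \<gamma> p X = 0"
    using \<alpha> unfolding harmonic1_def by blast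
  have su: "smooth_fun A u" using u unfolding is_codiff1_def by blast
  have inner1: "inner1 A g (\<lambda>p X. a * \<mu> p X) \<eta> = (\<lambda>p. a * inner1 A g \<mu> \<eta> p)" for \<mu> \<eta>
    by (simp add: fun_eq_iff inner1_def Let_def sum_distrib_left mult.assoc)
  have inner2: "inner2 A g (\<lambda>p X Y. a * \<mu> p X Y) \<eta> = (\<lambda>p. a * inner2 A g \<mu> \<eta> p)" for \<mu> \<eta>
    by (simp add: fun_eq_iff inner2_def Let_def sum_distrib_left mult.assoc mult.left_commute)
  have "smooth_fun A (\<lambda>p. a * u p)"
    using su smooth_on_cmult unfolding smooth_fun_def by blast
  then have "is_codiff1 A g (\<lambda>p X. a * \<alpha> p X) (\<lambda>p. a * u p)"
    using u unfolding is_codiff1_def by (simp add: inner1 mult.assoc)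
  moreover have "smooth_form1 A (\<lambda>p X. a * \<gamma> p X)"
    by (rule smooth_form1_scale[OF A]) (use \<gamma> in \<open>auto simp: is_codiff2_def\<close>)
  then have "is_codiff2 A g (\<lambda>p X Y. a * \<beta> p X Y) (\<lambda>p X. a * \<gamma> p X)"
    using \<gamma> unfolding is_codiff2_def by (simp add: inner1 inner2)
  moreover have "d_fun (\<lambda>p. a * u p) p X + a * \<gamma> p X = 0" if X: "X \<in> tangent_space A p" for p X
    using 0[OF X] smooth_fun_cmult_derivation[OF A su X] by (simp add: d_fun_def flip: distrib_left)
  moreover have "smooth_form1 A (\<lambda>p X. a * \<alpha> p X)"
    by (rule smooth_form1_scale[OF A sm refl])
  moreover have "is_d1 A (\<lambda>p X. a * \<alpha> p X) (\<lambda>p X Y. a * \<beta> p X Y)"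
    by (rule is_d1_scale[OF A sm d refl])
  ultimately show ?thesis
    unfolding harmonic1_def using smooth_form2_scale[OF \<beta>, of a] by blast
qed

section \<open>Reparametrised isotopies\<close>

lemma Ck_on_reparam:
  fixes \<xi> :: "real \<Rightarrow> real"
  assumes "\<And>k. Ck_on k \<xi> UNIV"
  shows "Ck_on k (\<lambda>z::real \<times> (real^'n::finite). (\<xi> (fst z), snd z)) UNIV"
  by (intro Ck_on_Pair open_UNIV Ck_on_compose[OF _ _ _ assms] Ck_on_bounded_linear
      bounded_linear_fst bounded_linear_snd) auto

lemma smooth_map_family_reparam:
  assumes \<Phi>: "smooth_map_family A \<Phi>" and \<xi>: "\<And>k. Ck_on k \<xi> UNIV" "\<And>t. t \<in> {0..1} \<Longrightarrow> \<xi> t \<in> {0..1}"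
  shows "smooth_map_family A (\<lambda>t. \<Phi> (\<xi> t))"
  unfolding smooth_map_family_def
proof (intro conjI ballI)
  have "continuous_on ({0..1} \<times> UNIV) (\<lambda>(t, x). \<Phi> t x)" using \<Phi> unfolding smooth_map_family_def by blast
  moreover have "continuous_on ({0..1} \<times> UNIV) (\<lambda>z. (\<xi> (fst z), snd z))"
    using \<xi>(1)[of 0] by (auto intro!: continuous_intros intro: continuous_on_compose2[of UNIV \<xi>])
  ultimately have "continuous_on ({0..1} \<times> UNIV) (\<lambda>z. (\<lambda>(t, x). \<Phi> t x) (\<xi> (fst z), snd z))"
    by (rule continuous_on_compose2) (use \<xi>(2) in auto)
  then show "continuous_on ({0..1} \<times> UNIV) (\<lambda>(t, x). \<Phi> (\<xi> t) x)" by (simp add: case_prod_unfold)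
next
  fix c d assume cd: "c \<in> A" "d \<in> A"
  let ?T = "{(t, y). t \<in> {0..1} \<and> y \<in> cimg c \<and> \<Phi> t (cinv c y) \<in> fst d}"
    and ?S = "{(t, y). t \<in> {0..1} \<and> y \<in> cimg c \<and> \<Phi> (\<xi> t) (cinv c y) \<in> fst d}"
  have "smooth_on ?T (\<lambda>(t, y). snd d (\<Phi> t (cinv c y)))"
    using \<Phi> cd unfolding smooth_map_family_def by blast
  then have "smooth_on ?S (\<lambda>z. (\<lambda>(t, y). snd d (\<Phi> t (cinv c y))) (\<xi> (fst z), snd z))"
  proof (rule smooth_on_compose[OF _ Ck_on_reparam[OF \<xi>(1)]])
    show "(\<lambda>z. (\<xi> (fst z), snd z)) ` ?S \<subseteq> ?T"
      using \<xi>(2) by (intro image_subsetI) (simp add: case_prod_unfold)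
  qed
  then show "smooth_on ?S (\<lambda>(t, y). snd d (\<Phi> (\<xi> t) (cinv c y)))"
    by (simp add: case_prod_unfold)
qed

lemma smooth_on_reparam:
  fixes f :: "real \<times> (real^'n::finite) \<Rightarrow> real"
  assumes f: "smooth_on ({0..1} \<times> S) f" and \<xi>: "\<And>k. Ck_on k \<xi> UNIV" "\<And>t. t \<in> {0..1} \<Longrightarrow> \<xi> t \<in> {0..1}"
  shows "smooth_on ({0..1} \<times> S) (\<lambda>z. deriv \<xi> (fst z) * f (\<xi> (fst z), snd z))"
proof (rule smooth_on_mult)
  show "smooth_on ({0..1} \<times> S) (\<lambda>z. deriv \<xi> (fst z))"
    by (intro Ck_on_imp_smooth_on Ck_on_compose[OF _ _ _ Ck_on_imp_DERIV(2)[OF \<xi>(1)]]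
        Ck_on_bounded_linear bounded_linear_fst open_UNIV) auto
  show "smooth_on ({0..1} \<times> S) (\<lambda>z. f (\<xi> (fst z), snd z))"
    using \<xi>(2) by (intro smooth_on_compose[OF f Ck_on_reparam[OF \<xi>(1)]] image_subsetI)
      (simp add: mem_Times_iff)
qed

lemma smooth_fun_family_imp_smooth_fun:
  assumes "smooth_fun_family A U" "t \<in> {0..1}"
  shows "smooth_fun A (U t)"
  unfolding smooth_fun_def
proof
  fix c assume "c \<in> A"
  then have "smooth_on ({0..1} \<times> cimg c) (\<lambda>(t, y). U t (cinv c y))"
    using assms unfolding smooth_fun_family_def by blast
  then have "smooth_on (cimg c) (\<lambda>y. (\<lambda>(t, y). U t (cinv c y)) (t, y))"
    by (rule smooth_on_compose[OF _ Ck_on_Pair[OF open_UNIV Ck_on_const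
            Ck_on_bounded_linear[OF bounded_linear_ident open_UNIV]]]) (use assms(2) in auto)
  then show "smooth_on (cimg c) (\<lambda>y. U t (cinv c y))" by simp
qed

lemma isotopy_field_tangent:
  fixes \<Phi> :: "real \<Rightarrow> 'm::t2_space \<Rightarrow> 'm"
  assumes "smooth_atlas A" "smooth_map_family A \<Phi>" "t \<in> {0..1}" "bij (\<Phi> t)"
  shows "isotopy_field A \<Phi> t p \<in> tangent_space A p"
  using map_family_velocity[OF assms(1-3), of "inv (\<Phi> t) p"] assms(4)
  by (simp add: isotopy_field_def bij_is_surj surj_f_inv_f)

text \<open>The starting point \<open>inv (\<Phi> (\<xi> t)) p\<close> stays fixed while the curve
  parameter moves, so this is the chain rule along a single trajectory.\<close>

lemma isotopy_field_reparam:
  fixes \<Phi> :: "real \<Rightarrow> 'm::t2_space \<Rightarrow> 'm"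
  assumes "smooth_atlas A" "smooth_map_family A \<Phi>" "t \<in> {0..1}"
    and \<xi>: "\<And>k. Ck_on k \<xi> UNIV" "\<And>t. t \<in> {0..1} \<Longrightarrow> \<xi> t \<in> {0..1}"
  shows "isotopy_field A (\<lambda>t. \<Phi> (\<xi> t)) t p = (\<lambda>f. deriv \<xi> t * isotopy_field A \<Phi> (\<xi> t) p f)"
proof -
  have "continuous_on UNIV \<xi>" using \<xi>(1)[of 0] by simp
  from map_family_velocity_compose[OF assms(1-3) this Ck_on_imp_DERIV(1)[OF \<xi>(1)] \<xi>(2)]
  show ?thesis by (simp add: isotopy_field_def)
qed

lemma contraction_reparam:
  fixes \<Phi> :: "real \<Rightarrow> 'm::t2_space \<Rightarrow> 'm"
  assumes "smooth_atlas A" "smooth_tensor2 A \<omega>" "smooth_map_family A \<Phi>" "\<And>t. t \<in> {0..1} \<Longrightarrow> bij (\<Phi> t)"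
    and "t \<in> {0..1}" and \<xi>: "\<And>k. Ck_on k \<xi> UNIV" "\<And>t. t \<in> {0..1} \<Longrightarrow> \<xi> t \<in> {0..1}"
    and "X \<in> tangent_space A p"
  shows "contraction (isotopy_field A (\<lambda>t. \<Phi> (\<xi> t)) t) \<omega> p X
      = deriv \<xi> t * contraction (isotopy_field A \<Phi> (\<xi> t)) \<omega> p X"
proof -
  have "isotopy_field A (\<lambda>t. \<Phi> (\<xi> t)) t p = (\<lambda>f. deriv \<xi> t * isotopy_field A \<Phi> (\<xi> t) p f)"
    by (rule isotopy_field_reparam) (rule assms | assumption)+
  moreover have "isotopy_field A \<Phi> (\<xi> t) p \<in> tangent_space A p"
    by (rule isotopy_field_tangent) (rule assms | assumption)+
  ultimately show ?thesis
    unfolding contraction_def using tensor2_cmult(2)[OF assms(1,2) _ assms(8)] by simp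
qed

definition reparam_generator :: "(real \<Rightarrow> real) \<Rightarrow> 'm generator \<Rightarrow> 'm generator" where
  "reparam_generator \<xi> = (\<lambda>(U, H). (\<lambda>t p. deriv \<xi> t * U (\<xi> t) p, \<lambda>t p X. deriv \<xi> t * H (\<xi> t) p X))"

text \<open>Assumes a smooth family of bijections instead of a symplectic isotopy, so that it also
  applies to the family of inverse maps.\<close>

lemma is_generator_reparam:
  fixes \<Phi> :: "real \<Rightarrow> 'm::t2_space \<Rightarrow> 'm"
  assumes A: "smooth_atlas A" and \<omega>: "smooth_tensor2 A \<omega>" and \<Phi>: "smooth_map_family A \<Phi>"
    "\<And>t. t \<in> {0..1} \<Longrightarrow> bij (\<Phi> t)"
    and gen: "is_generator A n \<omega> g \<Phi> G"
    and \<xi>: "\<And>k. Ck_on k \<xi> UNIV" "\<And>t. t \<in> {0..1} \<Longrightarrow> \<xi> t \<in> {0..1}"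
  shows "is_generator A n \<omega> g (\<lambda>t. \<Phi> (\<xi> t)) (reparam_generator \<xi> G)"
proof -
  obtain U H where G: "G = (U, H)" by fastforce
  have U: "smooth_fun_family A U" and H: "smooth_form1_family A H"
    using gen by (auto simp: is_generator_def G)
  have "smooth_fun_family A (\<lambda>t p. deriv \<xi> t * U (\<xi> t) p)"
    unfolding smooth_fun_family_def
  proof
    fix c assume "c \<in> A"
    then have "smooth_on ({0..1} \<times> cimg c) (\<lambda>(t, y). U t (cinv c y))"
      using U unfolding smooth_fun_family_def by blast
    from smooth_on_reparam[OF this \<xi>]
    show "smooth_on ({0..1} \<times> cimg c) (\<lambda>(t, y). deriv \<xi> t * U (\<xi> t) (cinv c y))"
      by (simp add: case_prod_unfold)
  qed
  moreover have "smooth_form1_family A (\<lambda>t p X. deriv \<xi> t * H (\<xi> t) p X)"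
    unfolding smooth_form1_family_def
  proof (intro ballI allI)
    fix c v assume "c \<in> A"
    then have "smooth_on ({0..1} \<times> cimg c) (\<lambda>(t, y). comp1 A (H t) c v y)"
      using H unfolding smooth_form1_family_def by blast
    from smooth_on_reparam[OF this \<xi>]
    show "smooth_on ({0..1} \<times> cimg c) (\<lambda>(t, y). comp1 A (\<lambda>p X. deriv \<xi> t * H (\<xi> t) p X) c v y)"
      by (simp add: case_prod_unfold comp1_def)
  qed
  moreover have "harmonic1 A g (\<lambda>p X. deriv \<xi> t * H (\<xi> t) p X)"
      "(\<integral>p. deriv \<xi> t * U (\<xi> t) p \<partial>symplectic_volume A n \<omega>) = 0" if t: "t \<in> {0..1}" for t
    using gen \<xi>(2)[OF t] by (auto simp: is_generator_def G intro: harmonic1_scale[OF A])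
  moreover have "contraction (isotopy_field A (\<lambda>t. \<Phi> (\<xi> t)) t) \<omega> p X
      = d_fun (\<lambda>p. deriv \<xi> t * U (\<xi> t) p) p X + deriv \<xi> t * H (\<xi> t) p X"
    if t: "t \<in> {0..1}" and X: "X \<in> tangent_space A p" for t p X
  proof -
    have "contraction (isotopy_field A \<Phi> (\<xi> t)) \<omega> p X = X (U (\<xi> t)) + H (\<xi> t) p X"
      using gen \<xi>(2)[OF t] X by (auto simp: is_generator_def G d_fun_def)
    then show ?thesis
      using contraction_reparam[OF A \<omega> \<Phi> t \<xi> X]
        smooth_fun_cmult_derivation[OF A smooth_fun_family_imp_smooth_fun[OF U \<xi>(2)[OF t]] X]
      by (simp add: d_fun_def distrib_left)
  qed
  ultimately show ?thesis by (simp add: is_generator_def reparam_generator_def G)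
qed

lemma symplectic_isotopy_reparam:
  fixes \<Phi> :: "real \<Rightarrow> 'm::t2_space \<Rightarrow> 'm"
  assumes A: "smooth_atlas A" and \<omega>: "smooth_tensor2 A \<omega>" and \<Phi>: "symplectic_isotopy A \<omega> \<Phi>"
    and \<xi>: "\<And>k. Ck_on k \<xi> UNIV" "\<And>t. t \<in> {0..1} \<Longrightarrow> \<xi> t \<in> {0..1}" "\<xi> 0 = 0"
  shows "symplectic_isotopy A \<omega> (\<lambda>t. \<Phi> (\<xi> t))"
proof -
  have iso: "smooth_map_family A \<Phi>" "\<And>t. t \<in> {0..1} \<Longrightarrow> bij (\<Phi> t)"
    "smooth_map_family A (\<lambda>t. inv (\<Phi> t))" "\<Phi> 0 = id"
    using \<Phi> by (auto simp: symplectic_isotopy_def smooth_isotopy_def)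
  have "closed_form1 A (contraction (isotopy_field A (\<lambda>t. \<Phi> (\<xi> t)) t) \<omega>)" if t: "t \<in> {0..1}" for t
  proof (rule closed_form1_scale[OF A])
    show "closed_form1 A (contraction (isotopy_field A \<Phi> (\<xi> t)) \<omega>)"
      using \<Phi> \<xi>(2)[OF t] by (auto simp: symplectic_isotopy_def)
    show "contraction (isotopy_field A (\<lambda>t. \<Phi> (\<xi> t)) t) \<omega> p X
        = deriv \<xi> t * contraction (isotopy_field A \<Phi> (\<xi> t)) \<omega> p X"
      if "X \<in> tangent_space A p" for p X
      by (rule contraction_reparam) (rule A \<omega> iso t \<xi> that | assumption)+
  qed
  then show ?thesis
    using iso \<xi> smooth_map_family_reparam[OF iso(1) \<xi>(1,2)] smooth_map_family_reparam[OF iso(3) \<xi>(1,2)]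
    by (simp add: symplectic_isotopy_def smooth_isotopy_def)
qed

section \<open>Bounds on compact manifolds\<close>

text \<open>The functions to be bounded have continuous formulas in charts only; with a local
  hypothesis these need not be patched together. Near z the value stays below f z + 1, and finitely
  many such neighbourhoods suffice.\<close>

lemma compact_locally_continuous_bounded_above:
  fixes f :: "'a::topological_space \<Rightarrow> real"
  assumes K: "compact K" and f: "\<And>z. z \<in> K \<Longrightarrow> \<exists>V. open V \<and> z \<in> V \<and> continuous_on (K \<inter> V) f"
  obtains B where "\<And>z. z \<in> K \<Longrightarrow> f z \<le> B"
proof -
  have "\<exists>W. open W \<and> z \<in> W \<and> (\<forall>y\<in>K \<inter> W. f y \<le> f z + 1)" if z: "z \<in> K" for z
  proof -
    obtain V where V: "open V" "z \<in> V" "continuous_on (K \<inter> V) f" using f[OF z] by blast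
    then obtain A where A: "open A" "A \<inter> (K \<inter> V) = f -` {..<f z + 1} \<inter> (K \<inter> V)"
      unfolding continuous_on_open_invariant by (metis open_lessThan)
    have "f y \<le> f z + 1" if "y \<in> K \<inter> (A \<inter> V)" for y
    proof -
      have "y \<in> f -` {..<f z + 1} \<inter> (K \<inter> V)" using that unfolding A(2)[symmetric] by blast
      then show ?thesis by simp
    qed
    moreover have "z \<in> A" using A(2) V(2) z by auto
    ultimately show ?thesis using V A(1) by (intro exI[of _ "A \<inter> V"]) auto
  qed
  then obtain W where W: "\<And>z. z \<in> K \<Longrightarrow> open (W z)" "\<And>z. z \<in> K \<Longrightarrow> z \<in> W z"
      "\<And>z y. z \<in> K \<Longrightarrow> y \<in> K \<inter> W z \<Longrightarrow> f y \<le> f z + 1"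
    by metis
  obtain Z where Z: "Z \<subseteq> K" "finite Z" "K \<subseteq> (\<Union>z\<in>Z. W z)"
    using compactE_image[OF K, of K W] W(1,2) by blast
  show ?thesis
  proof
    fix y assume y: "y \<in> K"
    then obtain z where z: "z \<in> Z" "y \<in> W z" using Z by blast
    then have "f y \<le> f z + 1" using W(3)[of z y] Z y by blast
    \<comment> \<open>A sum of absolute values replaces the maximum, which would need a nonempty
      Z.\<close>
    also have "\<dots> \<le> (\<Sum>z\<in>Z. \<bar>f z\<bar>) + 1"
      using member_le_sum[of z Z "\<lambda>z. \<bar>f z\<bar>"] z Z(2) by auto
    finally show "f y \<le> (\<Sum>z\<in>Z. \<bar>f z\<bar>) + 1" .
  qed
qed

lemma smooth_fun_family_bounded:
  fixes A :: "('m::t2_space, 'n::finite) chart set"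
  assumes A: "smooth_atlas A" and M: "compact (UNIV :: 'm set)" and U: "smooth_fun_family A U"
  obtains B where "\<And>t p. t \<in> {0..1} \<Longrightarrow> \<bar>U t p\<bar> \<le> B"
proof -
  let ?K = "{0..1} \<times> UNIV :: (real \<times> 'm) set"
  have "\<exists>V. open V \<and> z \<in> V \<and> continuous_on (?K \<inter> V) (\<lambda>z. \<bar>U (fst z) (snd z)\<bar>)" for z
  proof -
    obtain c where c: "c \<in> A" "snd z \<in> fst c" using atlas_covers[OF A] .
    note C = atlas_chart[OF A c(1)]
    let ?V = "UNIV \<times> fst c :: (real \<times> 'm) set"
    have "continuous_on ({0..1} \<times> cimg c) (\<lambda>(t, y). U t (cinv c y))"
      using U c unfolding smooth_fun_family_def by (blast intro: smooth_on_imp_continuous_on)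
    moreover have "continuous_on (?K \<inter> ?V) (\<lambda>z. (fst z, snd c (snd z)))"
      by (intro continuous_on_Pair continuous_on_fst continuous_on_id
          continuous_on_compose2[OF C(3) continuous_on_snd[OF continuous_on_id]]) auto
    ultimately have "continuous_on (?K \<inter> ?V) (\<lambda>z. (\<lambda>(t, y). U t (cinv c y)) (fst z, snd c (snd z)))"
      by (rule continuous_on_compose2) (auto simp: mem_Times_iff)
    then have "continuous_on (?K \<inter> ?V) (\<lambda>z. U (fst z) (snd z))"
      by (rule continuous_on_eq) (simp add: C(5) mem_Times_iff)
    then have "continuous_on (?K \<inter> ?V) (\<lambda>z. \<bar>U (fst z) (snd z)\<bar>)"
      by (rule continuous_on_rabs)
    moreover have "open ?V" "z \<in> ?V" using C(1) c by (auto simp: open_Times mem_Times_iff)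
    ultimately show ?thesis by blast
  qed
  moreover have "compact ?K" by (intro compact_Times M compact_Icc)
  ultimately obtain B where "\<And>z. z \<in> ?K \<Longrightarrow> \<bar>U (fst z) (snd z)\<bar> \<le> B"
    using compact_locally_continuous_bounded_above[of ?K "\<lambda>z. \<bar>U (fst z) (snd z)\<bar>"] by blast
  then show ?thesis by (intro that[of B]) force
qed

text \<open>A bound for one tangent vector at a time is all that \<open>coefficients_bounded\<close>
  asks for, so compactness of [0,1] is enough.\<close>

lemma smooth_form1_family_bounded:
  assumes A: "smooth_atlas A" and H: "smooth_form1_family A H" and X: "X \<in> tangent_space A p"
  shows "\<exists>B. \<forall>t\<in>{0..1}. \<bar>H t p X\<bar> \<le> B"
proof -
  obtain c v where c: "c \<in> A" "p \<in> fst c" and v: "X = tvec A c p v"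
    using X unfolding tangent_space_def by blast
  note C = atlas_chart[OF A c(1)]
  have "continuous_on ({0..1} \<times> cimg c) (\<lambda>(t, y). comp1 A (H t) c v y)"
    using H c unfolding smooth_form1_family_def by (blast intro: smooth_on_imp_continuous_on)
  then have "continuous_on {0..1} (\<lambda>t. (\<lambda>(t, y). comp1 A (H t) c v y) (t, snd c p))"
    by (rule continuous_on_compose2) (use C(6)[OF c(2)] in \<open>auto intro!: continuous_intros\<close>)
  then have "continuous_on {0..1} (\<lambda>t. H t p X)"
    by (simp add: comp1_def C(5)[OF c(2)] v)
  then have "bounded ((\<lambda>t. H t p X) ` {0..1})"
    by (intro compact_imp_bounded compact_continuous_image compact_Icc)
  then show ?thesis by (auto simp: bounded_iff)
qed

section \<open>Oscillation and the norm on harmonic forms\<close>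

lemma osc_le:
  assumes "\<And>x. \<bar>f x\<bar> \<le> B"
  shows "osc f \<le> 2 * B"
proof -
  have "(SUP x. f x) \<le> B" by (rule cSUP_least) (use assms abs_le_D1 in auto)
  moreover have "- B \<le> (INF x. f x)"
  proof (rule cINF_greatest)
    show "- B \<le> f x" for x using abs_le_D2[OF assms[of x]] by simp
  qed auto
  ultimately show ?thesis by (simp add: osc_def)
qed

text \<open>\<open>hnorm\<close> is a definite description; linear independence of the basis makes
  the coefficients below b unique, so any expansion computes it.\<close>

lemma hnorm_eq:
  assumes h: "harmonic_basis A g b h" and \<alpha>: "\<And>p X. X \<in> tangent_space A p \<Longrightarrow> \<alpha> p X = (\<Sum>i<b. l i * h i p X)"
  shows "hnorm A b h \<alpha> = (\<Sum>i<b. \<bar>l i\<bar>)"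
  unfolding hnorm_def
proof (rule the_equality)
  show "\<exists>l'. (\<forall>p. \<forall>X\<in>tangent_space A p. \<alpha> p X = (\<Sum>i<b. l' i * h i p X)) \<and> (\<Sum>i<b. \<bar>l i\<bar>) = (\<Sum>i<b. \<bar>l' i\<bar>)"
    using \<alpha> by blast
next
  fix s assume "\<exists>l'. (\<forall>p. \<forall>X\<in>tangent_space A p. \<alpha> p X = (\<Sum>i<b. l' i * h i p X)) \<and> s = (\<Sum>i<b. \<bar>l' i\<bar>)"
  then obtain l' where l': "\<And>p X. X \<in> tangent_space A p \<Longrightarrow> \<alpha> p X = (\<Sum>i<b. l' i * h i p X)"
      and s: "s = (\<Sum>i<b. \<bar>l' i\<bar>)"
    by blast
  have "(\<Sum>i<b. (l' i - l i) * h i p X) = 0" if "X \<in> tangent_space A p" for p X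
    using \<alpha>[OF that] l'[OF that] by (simp add: left_diff_distrib sum_subtractf)
  then have "\<forall>i<b. l' i - l i = 0"
    using h unfolding harmonic_basis_def by (elim conjE allE[of _ "\<lambda>i. l' i - l i"]) blast
  then show "s = (\<Sum>i<b. \<bar>l i\<bar>)" unfolding s by (intro sum.cong) auto
qed

text \<open>Gaussian elimination: subtract multiples of the last function so that the others vanish at a
  point where it does not.\<close>

lemma coefficients_bounded:
  fixes f :: "nat \<Rightarrow> 'x \<Rightarrow> real" and F :: "'t \<Rightarrow> 'x \<Rightarrow> real"
  assumes "\<And>l. (\<And>x. x \<in> D \<Longrightarrow> (\<Sum>i<b. l i * f i x) = 0) \<Longrightarrow> \<forall>i<b. l i = 0"
    and "\<And>t x. t \<in> T \<Longrightarrow> x \<in> D \<Longrightarrow> F t x = (\<Sum>i<b. l t i * f i x)"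
    and "\<And>x. x \<in> D \<Longrightarrow> \<exists>B. \<forall>t\<in>T. \<bar>F t x\<bar> \<le> B"
  shows "\<exists>B. \<forall>t\<in>T. \<forall>i<b. \<bar>l t i\<bar> \<le> B"
  using assms
proof (induction b arbitrary: f F)
  case 0
  then show ?case by simp
next
  case (Suc b)
  \<comment> \<open>Otherwise the last function vanishes on all of D, and the coefficients with a
    single 1 at index b contradict independence.\<close>
  obtain x0 where x0: "x0 \<in> D" "f b x0 \<noteq> 0"
  proof (rule ccontr)
    assume "\<not> thesis"
    then have "\<And>x. x \<in> D \<Longrightarrow> (\<Sum>i<Suc b. (if i = b then 1 else 0) * f i x) = 0"
      using that by auto
    from Suc.prems(1)[OF this] show False by auto
  qed
  define c where "c = (\<lambda>i. f i x0 / f b x0)"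
  define g where "g = (\<lambda>i x. f i x - c i * f b x)"
  define G where "G = (\<lambda>t x. F t x - F t x0 / f b x0 * f b x)"
  obtain B0 where B0: "\<And>t. t \<in> T \<Longrightarrow> \<bar>F t x0\<bar> \<le> B0" using Suc.prems(3)[OF x0(1)] by blast
  \<comment> \<open>Evaluation at x0 expresses the last coefficient by a bounded quantity and the
    earlier coefficients. It serves twice: to eliminate that coefficient from G, and to bound it at
    the end.\<close>
  have lb: "l t b = F t x0 / f b x0 - (\<Sum>i<b. l t i * c i)" if "t \<in> T" for t
    using Suc.prems(2)[OF that x0(1)] x0(2)
    by (simp add: c_def add_divide_distrib sum_divide_distrib)
  have "\<exists>B. \<forall>t\<in>T. \<forall>i<b. \<bar>l t i\<bar> \<le> B"
  proof (rule Suc.IH[of g G])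
    fix k assume k: "\<And>x. x \<in> D \<Longrightarrow> (\<Sum>i<b. k i * g i x) = 0"
    \<comment> \<open>Extends a relation among the reduced functions to one among the original
      functions, so that independence is inherited.\<close>
    define k' where "k' = (\<lambda>i. if i < b then k i else - (\<Sum>j<b. k j * c j))"
    have eq: "(\<Sum>i<Suc b. k' i * f i x) = (\<Sum>i<b. k i * g i x)" for x
    proof -
      have "(\<Sum>i<b. k' i * f i x) = (\<Sum>i<b. k i * f i x)" by (simp add: k'_def)
      then show ?thesis
        by (simp add: k'_def g_def right_diff_distrib sum_subtractf sum_distrib_right mult.assoc)
    qed
    have "\<forall>i<Suc b. k' i = 0" by (rule Suc.prems(1)[of k', unfolded eq, OF k])
    then show "\<forall>i<b. k i = 0" by (auto simp: k'_def split: if_splits)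
  next
    show "G t x = (\<Sum>i<b. l t i * g i x)" if "t \<in> T" "x \<in> D" for t x
    proof -
      have F0: "F t x0 / f b x0 = l t b + (\<Sum>i<b. l t i * c i)" using lb[OF that(1)] by simp
      have "G t x = F t x - (l t b + (\<Sum>i<b. l t i * c i)) * f b x"
        unfolding G_def F0 ..
      then show ?thesis using Suc.prems(2)[OF that]
        by (simp add: g_def right_diff_distrib sum_subtractf sum_distrib_right mult.assoc distrib_right)
    qed
    show "\<exists>B. \<forall>t\<in>T. \<bar>G t x\<bar> \<le> B" if x: "x \<in> D" for x
    proof -
      obtain B where B: "\<And>t. t \<in> T \<Longrightarrow> \<bar>F t x\<bar> \<le> B" using Suc.prems(3)[OF x] by blast
      have "\<bar>G t x\<bar> \<le> B + B0 / \<bar>f b x0\<bar> * \<bar>f b x\<bar>" if t: "t \<in> T" for t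
      proof -
        have "\<bar>F t x0 / f b x0 * f b x\<bar> \<le> B0 / \<bar>f b x0\<bar> * \<bar>f b x\<bar>"
          using B0[OF t] by (auto simp: abs_mult intro!: mult_right_mono divide_right_mono)
        then show ?thesis using B[OF t] abs_triangle_ineq4[of "F t x" "F t x0 / f b x0 * f b x"]
          by (simp add: G_def)
      qed
      then show ?thesis by blast
    qed
  qed
  then obtain B where B: "\<And>t i. t \<in> T \<Longrightarrow> i < b \<Longrightarrow> \<bar>l t i\<bar> \<le> B" by blast
  define B' where "B' = B0 / \<bar>f b x0\<bar> + (\<Sum>i<b. B * \<bar>c i\<bar>)"
  have "\<bar>l t b\<bar> \<le> B'" if t: "t \<in> T" for t
  proof -
    have "\<bar>F t x0 / f b x0\<bar> \<le> B0 / \<bar>f b x0\<bar>"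
      using B0[OF t] by (auto intro!: divide_right_mono)
    moreover have "\<bar>\<Sum>i<b. l t i * c i\<bar> \<le> (\<Sum>i<b. B * \<bar>c i\<bar>)"
      by (rule order_trans[OF sum_abs]) (use B[OF t] in \<open>auto simp: abs_mult intro!: sum_mono mult_right_mono\<close>)
    ultimately show ?thesis unfolding lb[OF t] B'_def
      using abs_triangle_ineq4[of "F t x0 / f b x0" "\<Sum>i<b. l t i * c i"] by linarith
  qed
  then have "\<bar>l t i\<bar> \<le> max B B'" if "t \<in> T" "i < Suc b" for t i
    using B[of t i] that by (cases "i = b") (auto simp: le_max_iff_disj)
  then show ?case by blast
qed

text \<open>The coefficients are picked separately for each time, without any regularity in t. Since
  the basis is independent as functions on the set of all tangent vectors, bounds on the evaluations
  of H bound them.\<close>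

lemma harmonic_family_coefficients_bounded:
  fixes A :: "('m::t2_space, 'n::finite) chart set"
  assumes A: "smooth_atlas A" and h: "harmonic_basis A g b h" and H: "smooth_form1_family A H"
    and harm: "\<And>t. t \<in> {0..1} \<Longrightarrow> harmonic1 A g (H t)"
  obtains l B where "\<And>t p X. t \<in> {0..1} \<Longrightarrow> X \<in> tangent_space A p \<Longrightarrow> H t p X = (\<Sum>i<b. l t i * h i p X)"
    "\<And>t i. t \<in> {0..1} \<Longrightarrow> i < b \<Longrightarrow> \<bar>l t i\<bar> \<le> B" "B \<ge> 0"
proof -
  have "\<exists>l. \<forall>p. \<forall>X\<in>tangent_space A p. H t p X = (\<Sum>i<b. l i * h i p X)" if "t \<in> {0..1}" for t
    using h harm[OF that] unfolding harmonic_basis_def by blast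
  then obtain l where l: "\<And>t p X. t \<in> {0..1} \<Longrightarrow> X \<in> tangent_space A p \<Longrightarrow> H t p X = (\<Sum>i<b. l t i * h i p X)"
    by metis
  let ?D = "Sigma UNIV (tangent_space A)"
  have "\<exists>B. \<forall>t\<in>{0..1}. \<forall>i<b. \<bar>l t i\<bar> \<le> B"
  proof (rule coefficients_bounded[where D = ?D and f = "\<lambda>i (p, X). h i p X" and F = "\<lambda>t (p, X). H t p X"])
    fix k assume k: "\<And>x. x \<in> ?D \<Longrightarrow> (\<Sum>i<b. k i * (case x of (p, X) \<Rightarrow> h i p X)) = 0"
    have "(\<Sum>i<b. k i * h i p X) = 0" if "X \<in> tangent_space A p" for p X
      using k[of "(p, X)"] that by simp
    then show "\<forall>i<b. k i = 0" using h unfolding harmonic_basis_def by blast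
  qed (use l smooth_form1_family_bounded[OF A H] in auto)
  then obtain B where "\<And>t i. t \<in> {0..1} \<Longrightarrow> i < b \<Longrightarrow> \<bar>l t i\<bar> \<le> B" by blast
  then have "\<And>t i. t \<in> {0..1} \<Longrightarrow> i < b \<Longrightarrow> \<bar>l t i\<bar> \<le> max B 0" by (simp add: le_max_iff_disj)
  with l show ?thesis by (intro that[of l "max B 0"]) auto
qed

section \<open>The estimate of \<open>D0\<close>\<close>

lemma integral_le_const:
  fixes f :: "real \<Rightarrow> real"
  assumes "f integrable_on {a..b}" "a \<le> b" "\<And>x. x \<in> {a..b} \<Longrightarrow> f x \<le> C"
  shows "integral {a..b} f \<le> C * (b - a)"
  using integral_le[OF assms(1) integrable_const_ivl[of C a b] assms(3)] assms(2)
  by (simp add: mult.commute)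

text \<open>A crude bound on the integrand holds at all times, and the integrand is at most 0 off
  two end intervals of total length 6 * \<open>\<delta>\<close>. Both facts use \<open>\<xi>\<close>
  only through \<open>flat_reparam\<close>, so the constant is uniform.\<close>

lemma D0_reparam_le:
  fixes A :: "('m::t2_space, 'n::finite) chart set"
  assumes A: "smooth_atlas A" and M: "compact (UNIV :: 'm set)" and h: "harmonic_basis A g b h"
    and U: "smooth_fun_family A U" and H: "smooth_form1_family A H"
    and harm: "\<And>t. t \<in> {0..1} \<Longrightarrow> harmonic1 A g (H t)"
    and C: "0 \<le> C"
  shows "\<exists>L. \<forall>\<xi> \<delta>. 0 < \<delta> \<and> \<delta> < 1/8 \<and> flat_reparam C \<delta> \<xi> \<longrightarrow>
    D0 A b h (U, H) (reparam_generator \<xi> (U, H)) \<le> L * \<delta>"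
proof -
  obtain B where B: "\<And>t p. t \<in> {0..1} \<Longrightarrow> \<bar>U t p\<bar> \<le> B"
    using smooth_fun_family_bounded[OF A M U] by blast
  obtain l B' where l: "\<And>t p X. t \<in> {0..1} \<Longrightarrow> X \<in> tangent_space A p \<Longrightarrow> H t p X = (\<Sum>i<b. l t i * h i p X)"
    and B': "\<And>t i. t \<in> {0..1} \<Longrightarrow> i < b \<Longrightarrow> \<bar>l t i\<bar> \<le> B'" "B' \<ge> 0"
    using harmonic_family_coefficients_bounded[OF A h H harm] by blast
  have "B \<ge> 0" using B[of 0 undefined] by (simp add: order_trans[OF abs_ge_zero])
  \<comment> \<open>The oscillation contributes 2 * B, and each of the b coefficients of the
    harmonic part at most B'. The factor 1 + C comes from comparing with a multiple by
    \<open>deriv \<xi> t\<close>.\<close>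
  define L where "L = 2 * B + real b * B'"
  have L: "L \<ge> 0" using \<open>B \<ge> 0\<close> B'(2) by (simp add: L_def)
  have "D0 A b h (U, H) (reparam_generator \<xi> (U, H)) \<le> L * (1 + C) * 6 * \<delta>"
    if \<delta>: "0 < \<delta>" "\<delta> < 1/8" and flat: "flat_reparam C \<delta> \<xi>" for \<xi> \<delta>
  proof -
    note \<xi> = flat_reparamD(2)[OF flat] and id = flat_reparamD(5)[OF flat] and d = flat_reparamD(7)[OF flat]
    define f where "f = (\<lambda>t. osc (\<lambda>x. U t x - deriv \<xi> t * U (\<xi> t) x)
        + hnorm A b h (\<lambda>p X. H t p X - deriv \<xi> t * H (\<xi> t) p X))"
    have prod: "\<bar>x - deriv \<xi> t * y\<bar> \<le> (1 + C) * K" if "\<bar>x\<bar> \<le> K" "\<bar>y\<bar> \<le> K" for x y K t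
    proof -
      have "\<bar>deriv \<xi> t * y\<bar> \<le> C * K"
        unfolding abs_mult using that d C by (intro mult_mono) auto
      then show ?thesis using that(1) abs_triangle_ineq4[of x "deriv \<xi> t * y"]
        by (simp add: distrib_right)
    qed
    have bound: "f t \<le> L * (1 + C)" if t: "t \<in> {0..1}" for t
    proof -
      have "osc (\<lambda>x. U t x - deriv \<xi> t * U (\<xi> t) x) \<le> 2 * ((1 + C) * B)"
        by (intro osc_le prod B t \<xi>)
      moreover have "hnorm A b h (\<lambda>p X. H t p X - deriv \<xi> t * H (\<xi> t) p X)
          = (\<Sum>i<b. \<bar>l t i - deriv \<xi> t * l (\<xi> t) i\<bar>)"
        by (rule hnorm_eq[OF h])
          (simp add: l[OF t] l[OF \<xi>[OF t]] left_diff_distrib sum_subtractf sum_distrib_left mult.assoc)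
      moreover have "\<dots> \<le> (\<Sum>i<b. (1 + C) * B')"
        by (intro sum_mono prod B' t \<xi>) auto
      ultimately show ?thesis by (simp add: f_def L_def algebra_simps)
    qed
    \<comment> \<open>The margin 3 * \<open>\<delta>\<close> instead of 2 * \<open>\<delta>\<close>
      leaves an open neighbourhood on which \<open>\<xi>\<close> is the identity, so that its
      derivative is 1. The bound 1/8 keeps 3 * \<open>\<delta>\<close> below 1 - 3 *
      \<open>\<delta>\<close>.\<close>
    have zero: "f t \<le> 0" if t: "t \<in> {3*\<delta>..1-3*\<delta>}" for t
    proof -
      have "deriv \<xi> t = 1"
      proof (rule DERIV_imp_deriv, rule has_field_derivative_transform_within_open[of "\<lambda>x. x" _ _ "{2*\<delta><..<1-2*\<delta>}"])
      qed (use t id \<delta> in auto)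
      moreover have "\<xi> t = t" using t id \<delta> by auto
      moreover have "osc (\<lambda>x::'m. 0) \<le> 2 * 0" by (rule osc_le) simp
      moreover have "hnorm A b h (\<lambda>p X. 0) = (\<Sum>i<b. \<bar>0\<bar>)" by (rule hnorm_eq[OF h]) simp
      ultimately show ?thesis by (simp add: f_def)
    qed
    have "integral {0..1} f \<le> L * (1 + C) * 6 * \<delta>"
    proof (cases "f integrable_on {0..1}")
      case True
      then have int: "f integrable_on {a..b}" if "0 \<le> a" "b \<le> 1" for a b
        using integrable_subinterval_real[of f 0 1 a b] that by auto
      have "integral {0..1} f = integral {0..3*\<delta>} f + (integral {3*\<delta>..1-3*\<delta>} f + integral {1-3*\<delta>..1} f)"
        using Henstock_Kurzweil_Integration.integral_combine[of 0 "3*\<delta>" 1 f]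
          Henstock_Kurzweil_Integration.integral_combine[of "3*\<delta>" "1-3*\<delta>" 1 f] int \<delta> by simp
      also have "\<dots> \<le> L * (1 + C) * (3*\<delta> - 0) + (0 * (1-3*\<delta> - 3*\<delta>) + L * (1 + C) * (1 - (1-3*\<delta>)))"
        by (intro add_mono integral_le_const int bound zero) (use \<delta> in auto)
      finally show ?thesis by (simp add: algebra_simps)
    next
      case False
      then show ?thesis using L C \<delta> by (simp add: not_integrable_integral)
    qed
    then show ?thesis
      by (simp add: D0_def reparam_generator_def f_def)
  qed
  then show ?thesis by blast
qed

section \<open>Riemannian distance along an isotopy\<close>

lemma riemannian_metric_nonneg:
  assumes A: "smooth_atlas A" and g: "riemannian_metric A g" and X: "X \<in> tangent_space A p"
  shows "g p X X \<ge> 0"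
proof (cases "X = (\<lambda>f. 0)")
  case True
  have "smooth_tensor2 A g" using g by (simp add: riemannian_metric_def)
  from tensor2_cmult(2)[OF A this X X, of 0] show ?thesis by (simp add: True)
next
  case False
  then show ?thesis using g X by (auto simp: riemannian_metric_def intro: less_imp_le)
qed

text \<open>Strictly inside a piece, the derivative within [0,1] sees this piece only and equals
  that of a local extension.\<close>

lemma smooth_curve_velocity_tangent:
  fixes \<gamma> :: "real \<Rightarrow> 'm::t2_space"
  assumes A: "smooth_atlas A" and \<gamma>: "smooth_curve_on A {a..b} \<gamma>" and s: "a < s" "s < b" "0 \<le> a" "b \<le> 1"
  shows "curve_velocity A {0..1} \<gamma> s \<in> tangent_space A (\<gamma> s)"
proof -
  obtain c where c: "c \<in> A" "\<gamma> s \<in> fst c" using atlas_covers[OF A] .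
  have "smooth_on {s\<in>{a..b}. \<gamma> s \<in> fst c} (\<lambda>s. snd c (\<gamma> s))"
    using \<gamma> c unfolding smooth_curve_on_def by blast
  moreover have "s \<in> {s\<in>{a..b}. \<gamma> s \<in> fst c}" using s c by simp
  ultimately obtain W F where W: "open W" "s \<in> W" and F: "\<forall>k. Ck_on k F W"
      "\<forall>s\<in>{s\<in>{a..b}. \<gamma> s \<in> fst c} \<inter> W. F s = snd c (\<gamma> s)"
    unfolding smooth_on_def by meson
  have "continuous_on {a..b} \<gamma>" using \<gamma> unfolding smooth_curve_on_def by blast
  then obtain N1 where N1: "open N1" "N1 \<inter> {a..b} = \<gamma> -` fst c \<inter> {a..b}"
    using atlas_chart(1)[OF A c(1)] unfolding continuous_on_open_invariant by blast
  define N where "N = N1 \<inter> {a<..<b} \<inter> W"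
  have "s \<in> N1 \<inter> {a..b}" unfolding N1(2) using s c by simp
  then have N: "open N" "s \<in> N"
    unfolding N_def using N1(1) W s by (intro open_Int open_greaterThanLessThan, auto)
  have in_c: "\<gamma> r \<in> fst c" if "r \<in> N" for r
  proof -
    have "r \<in> N1 \<inter> {a..b}" using that by (auto simp: N_def)
    then show ?thesis unfolding N1(2) by simp
  qed
  have F_eq: "F r = snd c (\<gamma> r)" if "r \<in> N" for r
    using F(2) in_c[OF that] that by (auto simp: N_def)
  have "F differentiable (at s)" using F(1)[rule_format, of 1] W(2) by simp
  then have "(F has_vector_derivative vector_derivative F (at s)) (at s within {0..1})"
    by (simp add: vector_derivative_works has_vector_derivative_at_within)
  then have "((\<lambda>s. snd c (\<gamma> s)) has_vector_derivative vector_derivative F (at s)) (at s within {0..1})"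
    unfolding has_vector_derivative_def
  proof (rule has_derivative_transform_eventually)
    show "eventually (\<lambda>r. F r = snd c (\<gamma> r)) (at s within {0..1})"
      using N F_eq by (auto simp: eventually_at_topological)
  qed (use s N F_eq in auto)
  then have "chart_velocity c \<gamma> s (vector_derivative F (at s))"
    using N in_c unfolding chart_velocity_def by blast
  then have "curve_velocity A {0..1} \<gamma> s = tvec A c (\<gamma> s) (vector_derivative F (at s))"
    by (rule curve_velocity_eq_tvec[OF A c(1), rotated]) (use s in auto)
  then show ?thesis using tvec_in_tangent_space[OF c] by simp
qed

text \<open>The integrand may be negative at the break points, where the velocity need not be a tangent
  vector; these form a null set.\<close>

lemma curve_length_nonneg:
  fixes \<gamma> :: "real \<Rightarrow> 'm::t2_space"
  assumes A: "smooth_atlas A" and g: "riemannian_metric A g" and \<gamma>: "piecewise_smooth_curve A \<gamma>"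
  shows "curve_length A g \<gamma> \<ge> 0"
proof -
  define f where "f = (\<lambda>s. sqrt (g (\<gamma> s) (curve_velocity A {0..1} \<gamma> s) (curve_velocity A {0..1} \<gamma> s)))"
  obtain k and \<tau> :: "nat \<Rightarrow> real" where \<tau>: "\<tau> 0 = 0" "\<tau> k = 1"
      "\<And>i. i < k \<Longrightarrow> \<tau> i < \<tau> (Suc i)" "\<And>i. i < k \<Longrightarrow> smooth_curve_on A {\<tau> i..\<tau> (Suc i)} \<gamma>"
    using \<gamma> unfolding piecewise_smooth_curve_def by blast
  have mono: "\<tau> i \<le> \<tau> j" if "i \<le> j" "j \<le> k" for i j
    using that
  proof (induction rule: dec_induct)
    case (step m)
    then show ?case using \<tau>(3)[of m] by simp
  qed simp
  have piece: "\<exists>i<j. \<tau> i < s \<and> s < \<tau> (Suc i)"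
    if "j \<le> k" "0 < s" "s < \<tau> j" "s \<notin> \<tau> ` {..k}" for s j
    using that
  proof (induction j)
    case 0
    then show ?case using \<tau>(1) by simp
  next
    case (Suc j)
    have "s \<noteq> \<tau> j" using Suc.prems by auto
    then show ?case using Suc by (cases "s < \<tau> j") (auto intro: less_SucI)
  qed
  have f: "f s = max 0 (f s)" if sI: "s \<in> {0..1} - \<tau> ` {..k}" for s
  proof -
    have "s \<noteq> \<tau> 0" "s \<noteq> \<tau> k" using sI by auto
    then have s: "0 < s" "s < \<tau> k" using sI \<tau>(1,2) by auto
    obtain i where i: "i < k" "\<tau> i < s" "s < \<tau> (Suc i)" using piece[OF le_refl s] sI by blast
    have "0 \<le> \<tau> i" "\<tau> (Suc i) \<le> 1" using mono[of 0 i] mono[of "Suc i" k] i(1) \<tau>(1,2) by auto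
    then have "curve_velocity A {0..1} \<gamma> s \<in> tangent_space A (\<gamma> s)"
      by (rule smooth_curve_velocity_tangent[OF A \<tau>(4)[OF i(1)] i(2,3)])
    then show ?thesis using riemannian_metric_nonneg[OF A g] by (simp add: f_def)
  qed
  have "integral {0..1} f = integral {0..1} (\<lambda>s. max 0 (f s))"
    by (rule integral_spike[of "\<tau> ` {..k}"]) (use f in auto)
  also have "\<dots> \<ge> 0"
    by (cases "(\<lambda>s. max 0 (f s)) integrable_on {0..1}")
      (auto intro: Henstock_Kurzweil_Integration.integral_nonneg simp: not_integrable_integral)
  finally show ?thesis by (simp add: curve_length_def f_def)
qed

text \<open>An infimum of reals is below its members only if the set is bounded below; nonnegativity
  of lengths provides the bound 0.\<close>

lemma rdist_le_curve_length:
  fixes \<gamma> :: "real \<Rightarrow> 'm::t2_space"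
  assumes "smooth_atlas A" "riemannian_metric A g" "piecewise_smooth_curve A \<gamma>"
  shows "rdist A g (\<gamma> 0) (\<gamma> 1) \<le> curve_length A g \<gamma>"
  unfolding rdist_def
proof (rule cInf_lower)
  show "bdd_below {curve_length A g \<eta> |\<eta>. piecewise_smooth_curve A \<eta> \<and> \<eta> 0 = \<gamma> 0 \<and> \<eta> 1 = \<gamma> 1}"
    by (rule bdd_belowI[of _ 0]) (use curve_length_nonneg[OF assms(1,2)] in auto)
qed (use assms(3) in auto)

text \<open>In a chart around the image point the squared speed is a finite sum of products of
  velocity coordinates and metric components. It is therefore locally continuous, and [0,1] x M is
  compact.\<close>

lemma map_family_speed_bounded:
  fixes A :: "('m::t2_space, 'n::finite) chart set"
  assumes A: "smooth_atlas A" and M: "compact (UNIV :: 'm set)" and g: "riemannian_metric A g"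
    and \<Phi>: "smooth_map_family A \<Phi>"
  obtains B where "\<And>t x. t \<in> {0..1} \<Longrightarrow>
    g (\<Phi> t x) (curve_velocity A {0..1} (\<lambda>s. \<Phi> s x) t) (curve_velocity A {0..1} (\<lambda>s. \<Phi> s x) t) \<le> B"
proof -
  let ?K = "{0..1} \<times> UNIV :: (real \<times> 'm) set"
  let ?v = "\<lambda>z. curve_velocity A {0..1} (\<lambda>s. \<Phi> s (snd z)) (fst z)"
  let ?f = "\<lambda>z. g (\<Phi> (fst z) (snd z)) (?v z) (?v z)"
  have "\<exists>V. open V \<and> z \<in> V \<and> continuous_on (?K \<inter> V) ?f" if z: "z \<in> ?K" for z
  proof -
    obtain d where d: "d \<in> A" "\<Phi> (fst z) (snd z) \<in> fst d" using atlas_covers[OF A] .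
    note D = atlas_chart[OF A d(1)]
    have "fst z \<in> {0..1}" using z by auto
    from map_family_chart_velocity[OF A \<Phi> this d]
    obtain W w where W: "open W" "z \<in> W" "continuous_on W w"
      and w: "\<And>t x. (t, x) \<in> W \<Longrightarrow> t \<in> {0..1} \<Longrightarrow>
        \<Phi> t x \<in> fst d \<and> chart_velocity d (\<lambda>s. \<Phi> s x) t (w (t, x))"
      by (metis prod.collapse)
    let ?y = "\<lambda>z. snd d (\<Phi> (fst z) (snd z))"
    let ?h = "\<lambda>z. \<Sum>(i, j)\<in>Basis \<times> Basis. (w z \<bullet> i) * ((w z \<bullet> j) * comp2 A g d i j (?y z))"
    have in_d: "\<Phi> (fst z) (snd z) \<in> fst d" if "z \<in> ?K \<inter> W" for z
      using w[of "fst z" "snd z"] that by auto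
    have "continuous_on (?K \<inter> W) (\<lambda>z. \<Phi> (fst z) (snd z))"
      using \<Phi> unfolding smooth_map_family_def
      by (auto simp: case_prod_unfold intro: continuous_on_subset)
    then have y: "continuous_on (?K \<inter> W) ?y"
      by (rule continuous_on_compose2[OF D(3)]) (use in_d in blast)
    have "continuous_on (cimg d) (comp2 A g d i j)" for i j
      using g d by (intro smooth_on_imp_continuous_on) (auto simp: riemannian_metric_def smooth_tensor2_def)
    then have comp: "continuous_on (?K \<inter> W) (\<lambda>z. comp2 A g d i j (?y z))" for i j
      by (rule continuous_on_compose2[OF _ y]) (use in_d in blast)
    have "continuous_on (?K \<inter> W) w" using W(3) by (rule continuous_on_subset) blast
    then have "continuous_on (?K \<inter> W) ?h"
      unfolding case_prod_unfold
      by (intro continuous_on_sum continuous_on_mult continuous_on_inner continuous_on_const comp)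
    moreover have "?h z = ?f z" if "z \<in> ?K \<inter> W" for z
    proof -
      have bl: "bilinear (\<lambda>v w. comp2 A g d v w (?y z))"
        using g d in_d[OF that] unfolding riemannian_metric_def smooth_tensor2_def by blast
      have "?v z = tvec A d (\<Phi> (fst z) (snd z)) (w z)"
        using curve_velocity_eq_tvec[OF A d(1), of "fst z" "\<lambda>s. \<Phi> s (snd z)"] w[of "fst z" "snd z"] that by auto
      then have "?f z = comp2 A g d (w z) (w z) (?y z)"
        using D(5)[OF in_d[OF that]] by (simp add: comp2_def)
      also have "\<dots> = comp2 A g d (\<Sum>i\<in>Basis. (w z \<bullet> i) *\<^sub>R i) (\<Sum>i\<in>Basis. (w z \<bullet> i) *\<^sub>R i) (?y z)"
        by (simp add: euclidean_representation)
      also have "\<dots> = ?h z"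
        unfolding bilinear_sum[OF bl] using bilinear_lmul[OF bl] bilinear_rmul[OF bl]
        by (intro sum.cong) auto
      finally show ?thesis by simp
    qed
    ultimately have "continuous_on (?K \<inter> W) ?f" by (rule continuous_on_eq)
    with W show ?thesis by blast
  qed
  moreover have "compact ?K" by (intro compact_Times M compact_Icc)
  ultimately obtain B where "\<And>z. z \<in> ?K \<Longrightarrow> ?f z \<le> B"
    using compact_locally_continuous_bounded_above[of ?K ?f] by blast
  then show ?thesis by (intro that[of B]) force
qed

text \<open>The trajectory between the times a and b competes in the infimum. Competing curves live
  on [0,1], so it is run through by an affine map; this multiplies the velocity by b - a and treats
  both orders of a and b at once.\<close>

lemma rdist_map_family_le:
  fixes A :: "('m::t2_space, 'n::finite) chart set"
  assumes A: "smooth_atlas A" and M: "compact (UNIV :: 'm set)" and g: "riemannian_metric A g"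
    and \<Phi>: "smooth_map_family A \<Phi>"
  obtains C where "C \<ge> 0" "\<And>a b x. a \<in> {0..1} \<Longrightarrow> b \<in> {0..1} \<Longrightarrow> rdist A g (\<Phi> a x) (\<Phi> b x) \<le> C * \<bar>a - b\<bar>"
proof -
  obtain B where B: "\<And>t x. t \<in> {0..1} \<Longrightarrow>
    g (\<Phi> t x) (curve_velocity A {0..1} (\<lambda>s. \<Phi> s x) t) (curve_velocity A {0..1} (\<lambda>s. \<Phi> s x) t) \<le> B"
    using map_family_speed_bounded[OF A M g \<Phi>] by blast
  show ?thesis
  \<comment> \<open>The absolute value makes the constant nonnegative whatever the sign of
    B.\<close>
  proof (rule that[of "sqrt \<bar>B\<bar>"])
    fix a b :: real and x assume ab: "a \<in> {0..1}" "b \<in> {0..1}"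
    define r where "r = (\<lambda>s. a + s * (b - a))"
    define \<gamma> where "\<gamma> = (\<lambda>s. \<Phi> (r s) x)"
    have Ckr: "Ck_on k r UNIV" for k unfolding r_def by (rule Ck_on_affine)
    have r01: "r s \<in> {0..1}" if "s \<in> {0..1}" for s
    proof -
      have "r s = (1 - s) * a + s * b" by (simp add: r_def algebra_simps)
      then show ?thesis using that ab convex_bound_le[of a 1 b "1 - s" s] by simp
    qed
    have r': "(r has_real_derivative (b - a)) (at s)" for s
      unfolding r_def by (auto intro!: derivative_eq_intros)
    have cont: "continuous_on UNIV r" using Ckr[of 0] by simp
    have \<Phi>r: "smooth_map_family A (\<lambda>t. \<Phi> (r t))" by (rule smooth_map_family_reparam[OF \<Phi> Ckr r01])
    have "smooth_curve_on A {0..1} \<gamma>"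
      unfolding smooth_curve_on_def
    proof (intro conjI ballI)
      have "continuous_on ({0..1} \<times> UNIV) (\<lambda>(t, x). \<Phi> (r t) x)"
        using \<Phi>r unfolding smooth_map_family_def by blast
      then have "continuous_on {0..1} (\<lambda>t. (\<lambda>(t, x). \<Phi> (r t) x) (t, x))"
        by (rule continuous_on_compose2) (auto intro!: continuous_intros)
      then show "continuous_on {0..1} \<gamma>" by (simp add: \<gamma>_def)
    next
      fix d assume d: "d \<in> A"
      obtain c where c: "c \<in> A" "x \<in> fst c" using atlas_covers[OF A] .
      note C = atlas_chart[OF A c(1)]
      have "smooth_on {(t, y). t \<in> {0..1} \<and> y \<in> cimg c \<and> \<Phi> (r t) (cinv c y) \<in> fst d}
          (\<lambda>(t, y). snd d (\<Phi> (r t) (cinv c y)))"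
        using \<Phi>r c d unfolding smooth_map_family_def by blast
      then have "smooth_on {s\<in>{0..1}. \<gamma> s \<in> fst d} (\<lambda>s. (\<lambda>(t, y). snd d (\<Phi> (r t) (cinv c y))) (s, snd c x))"
      proof (rule smooth_on_compose)
        show "Ck_on k (\<lambda>s. (s, snd c x)) UNIV" for k
          by (intro Ck_on_Pair open_UNIV Ck_on_const Ck_on_bounded_linear bounded_linear_ident)
      qed (use C(5,6)[OF c(2)] in \<open>auto simp: \<gamma>_def\<close>)
      then show "smooth_on {s\<in>{0..1}. \<gamma> s \<in> fst d} (\<lambda>s. snd d (\<gamma> s))"
        by (simp add: C(5)[OF c(2)] \<gamma>_def)
    qed
    then have "piecewise_smooth_curve A \<gamma>"
      \<comment> \<open>One smooth piece, with the break points 0 and 1.\<close>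
      unfolding piecewise_smooth_curve_def by (intro exI[of _ 1] exI[of _ real]) auto
    from rdist_le_curve_length[OF A g this]
    have "rdist A g (\<Phi> a x) (\<Phi> b x) \<le> curve_length A g \<gamma>" by (simp add: \<gamma>_def r_def)
    also have "\<dots> \<le> sqrt \<bar>B\<bar> * \<bar>a - b\<bar>"
    proof -
      let ?f = "\<lambda>s. sqrt (g (\<gamma> s) (curve_velocity A {0..1} \<gamma> s) (curve_velocity A {0..1} \<gamma> s))"
      have f: "?f s \<le> sqrt \<bar>B\<bar> * \<bar>a - b\<bar>" if s: "s \<in> {0..1}" for s
      proof -
        define X where "X = curve_velocity A {0..1} (\<lambda>s. \<Phi> s x) (r s)"
        have X: "X \<in> tangent_space A (\<Phi> (r s) x)"
          unfolding X_def by (rule map_family_velocity[OF A \<Phi> r01[OF s]])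
        have v: "curve_velocity A {0..1} \<gamma> s = (\<lambda>f. (b - a) * X f)"
          unfolding \<gamma>_def X_def by (rule map_family_velocity_compose[OF A \<Phi> s cont r' r01])
        have t2: "smooth_tensor2 A g" using g by (simp add: riemannian_metric_def)
        note scale = tensor2_cmult[OF A t2 X]
        have "g (\<Phi> (r s) x) (\<lambda>f. (b - a) * X f) (\<lambda>f. (b - a) * X f) = (b - a) * ((b - a) * g (\<Phi> (r s) x) X X)"
          using scale(2)[OF scale(1)[OF X]] scale(3)[OF X] by simp
        then have "?f s = \<bar>a - b\<bar> * sqrt (g (\<Phi> (r s) x) X X)"
          unfolding v by (simp add: \<gamma>_def real_sqrt_mult flip: mult.assoc)
            (simp add: abs_minus_commute)
        also have "\<dots> \<le> \<bar>a - b\<bar> * sqrt \<bar>B\<bar>"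
          using B[OF r01[OF s], of x] by (intro mult_left_mono) (auto simp: X_def)
        finally show ?thesis by (simp add: mult.commute)
      qed
      show ?thesis
      proof (cases "?f integrable_on {0..1}")
        case True
        from integral_le_const[OF this _ f] show ?thesis by (simp add: curve_length_def)
      next
        case False
        then show ?thesis by (simp add: curve_length_def not_integrable_integral)
      qed
    qed
    finally show "rdist A g (\<Phi> a x) (\<Phi> b x) \<le> sqrt \<bar>B\<bar> * \<bar>a - b\<bar>" .
  qed simp
qed

text \<open>\<open>d0\<close> compares inverse maps as well; they form a smooth family of their own,
  with its own Lipschitz constant in time. The factor 2 is that of
  \<open>\<bar>\<xi> t - t\<bar> \<le> 2 * \<delta>\<close>.\<close>

lemma dbar_reparam_le:
  fixes A :: "('m::t2_space, 'n::finite) chart set"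
  assumes A: "smooth_atlas A" and M: "compact (UNIV :: 'm set)" and g: "riemannian_metric A g"
    and \<Phi>: "smooth_map_family A \<Phi>" "smooth_map_family A (\<lambda>t. inv (\<Phi> t))"
  shows "\<exists>E. \<forall>\<xi> \<delta>. flat_reparam C \<delta> \<xi> \<longrightarrow> dbar A g (\<lambda>t. \<Phi> (\<xi> t)) \<Phi> \<le> E * \<delta>"
proof -
  obtain C1 where C1: "C1 \<ge> 0" "\<And>a b x. a \<in> {0..1} \<Longrightarrow> b \<in> {0..1} \<Longrightarrow>
      rdist A g (\<Phi> a x) (\<Phi> b x) \<le> C1 * \<bar>a - b\<bar>"
    using rdist_map_family_le[OF A M g \<Phi>(1)] by blast
  obtain C2 where C2: "C2 \<ge> 0" "\<And>a b x. a \<in> {0..1} \<Longrightarrow> b \<in> {0..1} \<Longrightarrow>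
      rdist A g (inv (\<Phi> a) x) (inv (\<Phi> b) x) \<le> C2 * \<bar>a - b\<bar>"
    using rdist_map_family_le[OF A M g \<Phi>(2)] by blast
  have "dbar A g (\<lambda>t. \<Phi> (\<xi> t)) \<Phi> \<le> max C1 C2 * 2 * \<delta>" if flat: "flat_reparam C \<delta> \<xi>" for \<xi> \<delta>
  proof -
    note \<xi> = flat_reparamD(2,6)[OF flat]
    have "d0 A g (\<Phi> (\<xi> t)) (\<Phi> t) \<le> max C1 C2 * (2 * \<delta>)" if t: "t \<in> {0..1}" for t
    proof -
      have "C1 * \<bar>\<xi> t - t\<bar> \<le> max C1 C2 * (2 * \<delta>)" "C2 * \<bar>\<xi> t - t\<bar> \<le> max C1 C2 * (2 * \<delta>)"
        using \<xi>(2)[OF t] C1(1) C2(1) by (auto intro!: mult_mono simp: le_max_iff_disj)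
      then have "rdist A g (\<Phi> (\<xi> t) x) (\<Phi> t x) \<le> max C1 C2 * (2 * \<delta>)"
          "rdist A g (inv (\<Phi> (\<xi> t)) x) (inv (\<Phi> t) x) \<le> max C1 C2 * (2 * \<delta>)" for x
        using C1(2)[OF \<xi>(1)[OF t] t, of x] C2(2)[OF \<xi>(1)[OF t] t, of x] by linarith+
      then show ?thesis
        unfolding d0_def dC0_def by (intro max.boundedI cSUP_least) auto
    qed
    then have "dbar A g (\<lambda>t. \<Phi> (\<xi> t)) \<Phi> \<le> max C1 C2 * (2 * \<delta>)"
      unfolding dbar_def by (intro cSUP_least) auto
    then show ?thesis by (simp add: mult.assoc)
  qed
  then show ?thesis by blast
qed

section \<open>Choice of \<open>\<delta>\<close> and conclusion\<close>

theorem lemma4p5: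
  fixes A :: "('m::t2_space, 'n::finite) chart set"
    and \<omega> g :: "'m form2"
    and n b :: nat
    and h :: "nat \<Rightarrow> 'm form1"
    and \<Phi> :: "real \<Rightarrow> 'm \<Rightarrow> 'm"
    and U U' :: "real \<Rightarrow> 'm \<Rightarrow> real"
    and H H' :: "real \<Rightarrow> 'm form1"
    and \<epsilon> :: real
  assumes "closed_connected_manifold A"
    and "CARD('n) = 2 * n"
    and "symplectic_form A \<omega>"
    and "riemannian_metric A g"
    and "harmonic_basis A g b h"
    and "symplectic_isotopy A \<omega> \<Phi>"
    and "is_generator A n \<omega> g \<Phi> (U, H)"
    and "is_generator A n \<omega> g (inverse_isotopy \<Phi>) (U', H')"
    and "\<epsilon> > 0"
  shows "\<exists>\<Psi> V K V' K'.
      symplectic_isotopy A \<omega> \<Psi> \<and>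
      is_generator A n \<omega> g \<Psi> (V, K) \<and>
      is_generator A n \<omega> g (inverse_isotopy \<Psi>) (V', K') \<and>
      boundary_flat A (V, K) \<and>
      \<Psi> 0 = \<Phi> 0 \<and> \<Psi> 1 = \<Phi> 1 \<and>
      D1 A b h (U, H) (U', H') (V, K) (V', K') < \<epsilon> \<and>
      dbar A g \<Psi> \<Phi> < \<epsilon>"
proof -
  have A: "smooth_atlas A" and M: "compact (UNIV :: 'm set)"
    using assms(1) by (auto simp: closed_connected_manifold_def)
  have \<omega>: "smooth_tensor2 A \<omega>"
    using assms(3) by (auto simp: symplectic_form_def closed_form2_def smooth_form2_def)
  have \<Phi>: "smooth_map_family A \<Phi>" "\<And>t. t \<in> {0..1} \<Longrightarrow> bij (\<Phi> t)"
    "smooth_map_family A (\<lambda>t. inv (\<Phi> t))" "\<And>t. t \<in> {0..1} \<Longrightarrow> bij (inv (\<Phi> t))"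
    using assms(6) by (auto simp: symplectic_isotopy_def smooth_isotopy_def bij_imp_bij_inv)
  have gen: "smooth_fun_family A U" "smooth_form1_family A H" "\<And>t. t \<in> {0..1} \<Longrightarrow> harmonic1 A g (H t)"
    using assms(7) by (auto simp: is_generator_def)
  have gen': "smooth_fun_family A U'" "smooth_form1_family A H'" "\<And>t. t \<in> {0..1} \<Longrightarrow> harmonic1 A g (H' t)"
    using assms(8) by (auto simp: is_generator_def)
  obtain C where C: "C \<ge> 0" "\<And>\<delta>. 0 < \<delta> \<Longrightarrow> \<delta> < 1/4 \<Longrightarrow> \<exists>\<xi>. flat_reparam C \<delta> \<xi>"
    using flat_reparam_exists by blast
  obtain L where L: "\<And>\<xi> \<delta>. 0 < \<delta> \<Longrightarrow> \<delta> < 1/8 \<Longrightarrow> flat_reparam C \<delta> \<xi> \<Longrightarrow>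
      D0 A b h (U, H) (reparam_generator \<xi> (U, H)) \<le> L * \<delta>"
    using D0_reparam_le[OF A M assms(5) gen C(1)] by blast
  obtain L' where L': "\<And>\<xi> \<delta>. 0 < \<delta> \<Longrightarrow> \<delta> < 1/8 \<Longrightarrow> flat_reparam C \<delta> \<xi> \<Longrightarrow>
      D0 A b h (U', H') (reparam_generator \<xi> (U', H')) \<le> L' * \<delta>"
    using D0_reparam_le[OF A M assms(5) gen' C(1)] by blast
  obtain E where E: "\<And>\<xi> \<delta>. flat_reparam C \<delta> \<xi> \<Longrightarrow> dbar A g (\<lambda>t. \<Phi> (\<xi> t)) \<Phi> \<le> E * \<delta>"
    using dbar_reparam_le[OF A M assms(4) \<Phi>(1,3)] by blast
  \<comment> \<open>No sign is known for L, L' and E, hence the absolute values; the 1 makes Q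
    positive. Then every c <= Q satisfies c * \<open>\<delta>\<close> <= \<open>\<epsilon>\<close> /
    2, which leaves room for the strict inequalities.\<close>
  define Q where "Q = \<bar>L\<bar> + \<bar>L'\<bar> + \<bar>E\<bar> + 1"
  define \<delta> where "\<delta> = min (1/16) (\<epsilon> / (2 * Q))"
  have "Q > 0" by (simp add: Q_def add_nonneg_pos)
  then have \<delta>: "0 < \<delta>" "\<delta> < 1/8" and Q\<delta>: "Q * \<delta> \<le> \<epsilon> / 2"
    using assms(9) by (auto simp: \<delta>_def min_def field_simps)
  have small: "c * \<delta> < \<epsilon>" if "c \<le> Q" for c
    using mult_right_mono[OF that, of \<delta>] \<delta>(1) Q\<delta> assms(9) by linarith
  have "\<delta> < 1/4" using \<delta>(2) by simp
  then obtain \<xi> where flat: "flat_reparam C \<delta> \<xi>"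
    using C(2)[OF \<delta>(1)] by blast
  note \<xi> = flat_reparamD[OF flat]
  define V where "V = (\<lambda>t p. deriv \<xi> t * U (\<xi> t) p)"
  define K where "K = (\<lambda>t p X. deriv \<xi> t * H (\<xi> t) p X)"
  define V' where "V' = (\<lambda>t p. deriv \<xi> t * U' (\<xi> t) p)"
  define K' where "K' = (\<lambda>t p X. deriv \<xi> t * H' (\<xi> t) p X)"
  have VK: "reparam_generator \<xi> (U, H) = (V, K)" "reparam_generator \<xi> (U', H') = (V', K')"
    by (simp_all add: reparam_generator_def V_def K_def V'_def K'_def)
  have "symplectic_isotopy A \<omega> (\<lambda>t. \<Phi> (\<xi> t))"
    using symplectic_isotopy_reparam[OF A \<omega> assms(6) \<xi>(1,2)] \<xi>(3)[of 0] \<delta>(1) by simp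
  moreover have "is_generator A n \<omega> g (\<lambda>t. \<Phi> (\<xi> t)) (V, K)"
    using is_generator_reparam[OF A \<omega> \<Phi>(1,2) assms(7) \<xi>(1,2)] VK by simp
  moreover have "is_generator A n \<omega> g (inverse_isotopy (\<lambda>t. \<Phi> (\<xi> t))) (V', K')"
    using is_generator_reparam[OF A \<omega> \<Phi>(3,4) assms(8)[unfolded inverse_isotopy_def] \<xi>(1,2)] VK
    by (simp add: inverse_isotopy_def)
  moreover have "boundary_flat A (V, K)"
  proof -
    \<comment> \<open>\<open>deriv\<close> is two-sided, so at the times 0 and 1 it matters that
      \<open>\<xi>\<close> is constant beyond [0,1] too.\<close>
    have "deriv \<xi> t = 0" if "t \<in> {0..<\<delta>} \<union> {1-\<delta><..1}" for t
    proof (cases "t < \<delta>")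
      case True
      show ?thesis
      proof (rule DERIV_imp_deriv, rule has_field_derivative_transform_within_open[of "\<lambda>x. 0" _ _ "{..<\<delta>}"])
      qed (use True \<xi>(3) in auto)
    next
      case False
      show ?thesis
      proof (rule DERIV_imp_deriv, rule has_field_derivative_transform_within_open[of "\<lambda>x. 1" _ _ "{1-\<delta><..}"])
      qed (use that False \<xi>(4) in auto)
    qed
    then show ?thesis
      unfolding boundary_flat_def V_def K_def using \<delta> by (auto intro!: exI[of _ \<delta>])
  qed
  moreover have "\<Phi> (\<xi> 0) = \<Phi> 0" "\<Phi> (\<xi> 1) = \<Phi> 1" using \<xi>(3)[of 0] \<xi>(4)[of 1] \<delta> by simp_all
  moreover have "D1 A b h (U, H) (U', H') (V, K) (V', K') < \<epsilon>"
  proof -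
    have "D0 A b h (U, H) (V, K) \<le> L * \<delta>" "D0 A b h (U', H') (V', K') \<le> L' * \<delta>"
      using L[OF \<delta> flat] L'[OF \<delta> flat] VK by simp_all
    moreover have "L * \<delta> < \<epsilon>" "L' * \<delta> < \<epsilon>"
      by (intro small; simp add: Q_def)+
    ultimately show ?thesis by (simp add: D1_def)
  qed
  moreover have "dbar A g (\<lambda>t. \<Phi> (\<xi> t)) \<Phi> < \<epsilon>"
    using E[OF flat] small[of E] unfolding Q_def by linarith
  ultimately show ?thesis by blast
qed

end
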